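(* Let $G$ be a uniformly $3$-connected graph on $n$ vertices. Then $$\nu(G)\ \ge\ \frac{2n+2}{3},$$ where $\nu(G)$ denotes the number of vertices of $G$ whose degree equals the minimum degree of $G$.
   Context: All graphs are finite, undirected and loopless, but may contain parallel edges. Paths using different parallel edges are different paths. Two or more (distinct) paths are independent if every vertex contained in more than one of the paths is an endpoint of all the paths it is contained in. A graph $G$ with at least $4$ vertices is uniformly $3$-connected if for every pair of distinct vertices of $G$ the maximum number of independent paths between them is exactly $3$. For a graph $G$, $\nu(G):=\big|\{v\in V(G):\deg(v)=\min_{w\in V(G)}\deg(w)\}\big|$. *)

theory Defs
  imports Complex_Main
begin

text \<open>
  Edges are abstract objects carrying a set of two end vertices, so distinct edges may be parallel
  and there are no loops. Isolated vertices are allowed.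
\<close>

record ('v, 'e) multigraph =
  verts :: "'v set"
  edges :: "'e set"
  ends :: "'e \<Rightarrow> 'v set"

locale fin_multigraph =
  fixes G :: "('v, 'e) multigraph"
  assumes finite_verts: "finite (verts G)"
    and finite_edges: "finite (edges G)"
    and ends_in_verts: "e \<in> edges G \<Longrightarrow> ends G e \<subseteq> verts G"
    and card_ends: "e \<in> edges G \<Longrightarrow> card (ends G e) = 2"

text \<open>
  A path is given by its vertex sequence together with its edge sequence, so that paths using
  different parallel edges are different. Every path from \<open>u\<close> to \<open>v\<close> with \<open>u \<noteq> v\<close> is represented
  exactly once, being listed in the direction from \<open>u\<close> to \<open>v\<close>.
\<close>

type_synonym ('v, 'e) mpath = "'v list \<times> 'e list"

definition is_path :: "('v, 'e) multigraph \<Rightarrow> ('v, 'e) mpath \<Rightarrow> bool" where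
  "is_path G p \<longleftrightarrow>
     length (fst p) = Suc (length (snd p)) \<and>
     distinct (fst p) \<and> set (fst p) \<subseteq> verts G \<and> set (snd p) \<subseteq> edges G \<and>
     (\<forall>i < length (snd p). ends G (snd p ! i) = {fst p ! i, fst p ! Suc i})"

definition path_verts :: "('v, 'e) mpath \<Rightarrow> 'v set" where
  "path_verts p = set (fst p)"

definition path_endpoints :: "('v, 'e) mpath \<Rightarrow> 'v set" where
  "path_endpoints p = {hd (fst p), last (fst p)}"

definition paths_between :: "('v, 'e) multigraph \<Rightarrow> 'v \<Rightarrow> 'v \<Rightarrow> ('v, 'e) mpath set" where
  "paths_between G u v = {p. is_path G p \<and> hd (fst p) = u \<and> last (fst p) = v}"

definition independent_paths :: "('v, 'e) mpath set \<Rightarrow> bool" where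
  "independent_paths P \<longleftrightarrow>
     (\<forall>w. (\<exists>p\<in>P. \<exists>q\<in>P. p \<noteq> q \<and> w \<in> path_verts p \<and> w \<in> path_verts q) \<longrightarrow>
          (\<forall>p\<in>P. w \<in> path_verts p \<longrightarrow> w \<in> path_endpoints p))"

definition max_independent_paths :: "('v, 'e) multigraph \<Rightarrow> 'v \<Rightarrow> 'v \<Rightarrow> nat" where
  "max_independent_paths G u v =
     Max (card ` {P. P \<subseteq> paths_between G u v \<and> independent_paths P})"

definition uniformly_3_connected :: "('v, 'e) multigraph \<Rightarrow> bool" where
  "uniformly_3_connected G \<longleftrightarrow>
     card (verts G) \<ge> 4 \<and>
     (\<forall>u\<in>verts G. \<forall>v\<in>verts G. u \<noteq> v \<longrightarrow> max_independent_paths G u v = 3)"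

definition degree :: "('v, 'e) multigraph \<Rightarrow> 'v \<Rightarrow> nat" where
  "degree G v = card {e \<in> edges G. v \<in> ends G e}"

definition min_degree :: "('v, 'e) multigraph \<Rightarrow> nat" where
  "min_degree G = Min (degree G ` verts G)"

definition num_min_degree :: "('v, 'e) multigraph \<Rightarrow> nat" where
  "num_min_degree G = card {v \<in> verts G. degree G v = min_degree G}"

text \<open>The maximum in \<^const>\<open>max_independent_paths\<close> is over a nonempty finite set of numbers.\<close>

lemma (in fin_multigraph) finite_paths_between: "finite (paths_between G u v)"
proof (rule finite_subset)
  let ?n = "card (verts G)"
  show "paths_between G u v \<subseteq>
      {xs. set xs \<subseteq> verts G \<and> length xs \<le> ?n} \<times> {es. set es \<subseteq> edges G \<and> length es \<le> ?n}"
  proof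
    fix p assume "p \<in> paths_between G u v"
    then have p: "is_path G p" by (simp add: paths_between_def)
    then have "length (fst p) \<le> ?n"
      using finite_verts by (metis is_path_def card_mono distinct_card)
    then show "p \<in> {xs. set xs \<subseteq> verts G \<and> length xs \<le> ?n} \<times>
                   {es. set es \<subseteq> edges G \<and> length es \<le> ?n}"
      using p by (auto simp: is_path_def mem_Times_iff)
  qed
  show "finite ({xs. set xs \<subseteq> verts G \<and> length xs \<le> ?n} \<times>
                {es. set es \<subseteq> edges G \<and> length es \<le> ?n})"
    by (intro finite_cartesian_product finite_lists_length_le finite_verts finite_edges)
qed

lemma (in fin_multigraph) finite_independent_path_sets:
  "finite {P. P \<subseteq> paths_between G u v \<and> independent_paths P}"
  by (rule finite_subset[of _ "Pow (paths_between G u v)"]) (auto simp: finite_paths_between)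

lemma independent_path_sets_nonempty:
  "{P. P \<subseteq> paths_between G u v \<and> independent_paths P} \<noteq> {}"
  by (auto simp: independent_paths_def intro!: exI[of _ "{}"])

end

theory Submission
  imports Defs
begin

text \<open>
  Subdivide every edge, so that separators consisting of vertices and edges become node sets. By
  Menger's theorem, every two vertices are separated by three nodes but not by two. Uncrossing shows
  that the three nodes can be chosen to be edges: if a vertex \<open>s\<close> had to be used, a crossing
  separation of \<open>s\<close> from one of the two vertices would exhibit another vertex joined to \<open>s\<close> by
  four independent paths. Hence every two vertices are separated by a 3-edge-cut. Now take the
  vertices of degree three as singleton parts and cut along a 3-edge-cut that separates two of the
  remaining \<open>h\<close> vertices and crosses no part; each side becomes a part of the other. After \<open>h - 1\<close>
  such cuts every piece is one vertex of degree at least four, with at most one edge into each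
  part, so it has at least four parts. Each cut adds two parts, so there were initially at least
  \<open>4 h - 2 (h - 1) = 2 h + 2\<close> of them.
\<close>

section \<open>Menger's theorem\<close>

text \<open>Separators that still contain vertices would not serve the count: only an edge cut puts
  every vertex on one side, so that the remaining vertices are shared out without loss. To remove
  the vertices, take a pair \<open>u\<close>, \<open>v\<close> whose cheapest separator of order
  three contains as many vertices as possible, and among its cheapest separations one with the
  smallest side at \<open>u\<close>. The first choice bounds the cost of separating \<open>u\<close>
  from a separator vertex \<open>s\<close>, which makes the submodular inequality for vertex counts
  tight; the second then excludes that \<open>v\<close> lies on the side of \<open>s\<close>. Only
  the other position of \<open>v\<close> leads to the hub. The obstacle there is that some corners
  may contain no vertex, so that connectivity says nothing about them. The substitute is that a
  separator vertex has two neighbours on either side, combined with the absence of parallel edges: a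
  corner bounded by \<open>s\<close> and one further node could hold at most one edge at
  \<open>s\<close>.\<close>

definition walk :: "('n \<times> 'n) set \<Rightarrow> 'n set \<Rightarrow> 'n set \<Rightarrow> 'n list \<Rightarrow> bool" where
  "walk r A B xs \<longleftrightarrow>
     xs \<noteq> [] \<and> successively (\<lambda>a b. (a, b) \<in> r) xs \<and> hd xs \<in> A \<and> last xs \<in> B"

text \<open>Walks may repeat nodes here, so two pieces glued at a common node can be tested against
  \<open>S\<close> directly; distinctness is demanded only in \<open>linkage\<close>.\<close>

definition meets_walks :: "('n \<times> 'n) set \<Rightarrow> 'n set \<Rightarrow> 'n set \<Rightarrow> 'n set \<Rightarrow> bool" where
  "meets_walks r A B S \<longleftrightarrow> (\<forall>xs. walk r A B xs \<longrightarrow> set xs \<inter> S \<noteq> {})"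

definition linkage :: "('n \<times> 'n) set \<Rightarrow> 'n set \<Rightarrow> 'n set \<Rightarrow> 'n list set \<Rightarrow> bool" where
  "linkage r A B P \<longleftrightarrow>
     (\<forall>p\<in>P. walk r A B p \<and> distinct p) \<and> (\<forall>p\<in>P. \<forall>q\<in>P. p \<noteq> q \<longrightarrow> set p \<inter> set q = {})"

section \<open>Cutting and joining walks\<close>

lemma walk_mono: "walk r A B xs \<Longrightarrow> r \<subseteq> r' \<Longrightarrow> walk r' A B xs"
  unfolding walk_def by (auto elim: successively_mono)

lemma linkage_mono: "linkage r A B P \<Longrightarrow> r \<subseteq> r' \<Longrightarrow> linkage r' A B P"
  unfolding linkage_def by (auto intro: walk_mono)

text \<open>The arc \<open>(x, y)\<close> is used only when the walk leaves \<open>x\<close>, which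
  cannot happen if \<open>x\<close> occurs at most as the last node.\<close>

lemma walk_avoiding_tail:
  assumes "walk (insert (x, y) r) A B xs" "x \<notin> set (butlast xs)"
  shows "walk r A B xs"
proof -
  have "successively (\<lambda>a b. (a, b) \<in> r) xs"
    if "successively (\<lambda>a b. (a, b) \<in> insert (x, y) r) xs" "x \<notin> set (butlast xs)" for xs
    using that by (induction xs rule: induct_list012) auto
  then show ?thesis using assms by (auto simp: walk_def)
qed

lemma walk_avoiding_head:
  assumes "walk (insert (x, y) r) A B xs" "y \<notin> set (tl xs)"
  shows "walk r A B xs"
proof -
  have "successively (\<lambda>a b. (a, b) \<in> r) xs"
    if "successively (\<lambda>a b. (a, b) \<in> insert (x, y) r) xs" "y \<notin> set (tl xs)" for xs
    using that by (induction xs rule: induct_list012) auto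
  then show ?thesis using assms by (auto simp: walk_def)
qed

lemma walk_prefix:
  assumes "walk r A B (xs @ z # ys)" shows "walk r A {z} (xs @ [z])"
  using assms by (auto simp: walk_def successively_append_iff hd_append)

lemma walk_suffix:
  assumes "walk r A B (xs @ z # ys)" shows "walk r {z} B (z # ys)"
  using assms by (auto simp: walk_def successively_append_iff)

lemma walk_join:
  assumes "walk r A {z} (xs @ [z])" "walk r {z} B (z # ys)"
  shows "walk r A B (xs @ z # ys)"
  using assms by (auto simp: walk_def successively_append_iff hd_append)

lemma set_tl_subset: "set (tl xs) \<subseteq> set xs"
  by (cases xs) auto

text \<open>Stop a walk at its first node in \<open>insert x S\<close>: this initial segment never
  leaves \<open>x\<close>, so it avoids the new arc and must meet \<open>T\<close>.\<close>

lemma meets_walks_first: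
  assumes S: "meets_walks (insert (x, y) r) A B (insert x S)"
    and T: "meets_walks r A (insert x S) T"
  shows "meets_walks (insert (x, y) r) A B T"
  unfolding meets_walks_def
proof (intro allI impI)
  fix xs assume w: "walk (insert (x, y) r) A B xs"
  then obtain z where "z \<in> set xs" "z \<in> insert x S"
    using S unfolding meets_walks_def by blast
  then obtain as z bs where xs: "xs = as @ z # bs" "z \<in> insert x S" "\<forall>a\<in>set as. a \<notin> insert x S"
    using split_list_first_prop[of xs "\<lambda>a. a \<in> insert x S"] by blast
  have "walk (insert (x, y) r) A {z} (as @ [z])"
    using w xs walk_prefix by metis
  then have "walk r A {z} (as @ [z])"
    using xs(3) by - (rule walk_avoiding_tail[of x y], auto)
  then have "walk r A (insert x S) (as @ [z])"
    using xs(2) by (auto simp: walk_def)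
  then show "set xs \<inter> T \<noteq> {}"
    using T xs(1) unfolding meets_walks_def by fastforce
qed

lemma meets_walks_last:
  assumes S: "meets_walks (insert (x, y) r) A B (insert y S)"
    and T: "meets_walks r (insert y S) B T"
  shows "meets_walks (insert (x, y) r) A B T"
  unfolding meets_walks_def
proof (intro allI impI)
  fix xs assume w: "walk (insert (x, y) r) A B xs"
  then obtain z where "z \<in> set xs" "z \<in> insert y S"
    using S unfolding meets_walks_def by blast
  then obtain as z bs where xs: "xs = as @ z # bs" "z \<in> insert y S" "\<forall>a\<in>set bs. a \<notin> insert y S"
    using split_list_last_prop[of xs "\<lambda>a. a \<in> insert y S"] by blast
  have "walk (insert (x, y) r) {z} B (z # bs)"
    using w xs walk_suffix by metis
  then have "walk r {z} B (z # bs)"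
    using xs(3) by - (rule walk_avoiding_head[of x y], auto)
  then have "walk r (insert y S) B (z # bs)"
    using xs(2) by (auto simp: walk_def)
  then show "set xs \<inter> T \<noteq> {}"
    using T xs(1) unfolding meets_walks_def by fastforce
qed

lemma meets_walks_insert_arc:
  assumes "meets_walks r A B S" "z = x \<or> z = y"
  shows "meets_walks (insert (x, y) r) A B (insert z S)"
  unfolding meets_walks_def
proof (intro allI impI)
  fix xs assume w: "walk (insert (x, y) r) A B xs"
  show "set xs \<inter> insert z S \<noteq> {}"
  proof (cases "z \<in> set xs")
    case False
    then have "walk r A B xs"
      using assms(2) walk_avoiding_tail[OF w] walk_avoiding_head[OF w] in_set_butlastD[of z xs]
        set_tl_subset[of xs] by blast
    then show ?thesis using assms(1) unfolding meets_walks_def by blast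
  qed auto
qed

text \<open>Disjoint walks have different last nodes, so \<open>k\<close> of them exhaust a target
  of size \<open>k\<close> and can be named by where they end.\<close>

lemma linkage_indexed:
  assumes "linkage r A B P" "card P = k" "card B = k" "finite B" "k > 0"
  obtains p where "\<And>s. s \<in> B \<Longrightarrow> p s \<in> P \<and> last (p s) = s"
proof -
  have "inj_on last P"
  proof (rule inj_onI)
    fix p q assume pq: "p \<in> P" "q \<in> P" "last p = last q"
    then have "p \<noteq> []" "q \<noteq> []" using assms(1) by (auto simp: linkage_def walk_def)
    then have "last p \<in> set p \<inter> set q" using pq(3) last_in_set[of p] last_in_set[of q] by simp
    then show "p = q" using pq assms(1) unfolding linkage_def by blast
  qed
  then have "card (last ` P) = card B" using assms(2,3) by (simp add: card_image)
  moreover have "last ` P \<subseteq> B" using assms(1) by (auto simp: linkage_def walk_def)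
  ultimately have "last ` P = B" using assms(4) by (simp add: card_subset_eq)
  then have "\<forall>s\<in>B. \<exists>p. p \<in> P \<and> last p = s" by blast
  then show ?thesis using that by metis
qed

lemma linkage_rev:
  assumes "linkage r A B P" shows "linkage (r\<inverse>) B A (rev ` P)"
  using assms unfolding linkage_def walk_def
  by (auto simp: successively_rev hd_rev last_rev)

text \<open>Goering's induction: if deleting the arc \<open>(x, y)\<close> destroys the bound, a smaller separator
  \<open>S\<close> of the remaining arcs becomes a minimum one by adding either \<open>x\<close> or \<open>y\<close>; linkages from
  \<open>A\<close> to \<open>S \<union> {x}\<close> and from \<open>S \<union> {y}\<close> to \<open>B\<close> are then glued along \<open>S\<close> and the arc.\<close>

theorem menger:
  assumes "finite r" "finite A"
    and "\<And>S. finite S \<Longrightarrow> meets_walks r A B S \<Longrightarrow> k \<le> card S"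
  shows "\<exists>P. linkage r A B P \<and> card P = k"
  using assms
proof (induction r arbitrary: A B)
  case empty
  have "walk {} A B xs \<longleftrightarrow> (\<exists>a\<in>A \<inter> B. xs = [a])" for xs
    by (cases xs; cases "tl xs") (auto simp: walk_def)
  then have "meets_walks {} A B (A \<inter> B)" by (auto simp: meets_walks_def)
  then have "k \<le> card (A \<inter> B)" using empty by blast
  then obtain D where D: "D \<subseteq> A \<inter> B" "card D = k" by (meson obtain_subset_with_card_n)
  have "linkage {} A B ((\<lambda>a. [a]) ` D)"
    using D by (auto simp: linkage_def walk_def)
  moreover have "card ((\<lambda>a. [a]) ` D) = k" using D by (simp add: card_image inj_on_def)
  ultimately show ?case by blast
next
  case (insert e r)
  obtain x y where e: "e = (x, y)" by fastforce
  show ?case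
  proof (cases "\<forall>S. finite S \<longrightarrow> meets_walks r A B S \<longrightarrow> k \<le> card S")
    case True
    then have "\<exists>P. linkage r A B P \<and> card P = k"
      using insert.IH[of A B] insert.prems(1) by metis
    then obtain P where "linkage r A B P" "card P = k" by blast
    then show ?thesis using linkage_mono[OF _ subset_insertI] by blast
  next
    case False
    then obtain S where S: "finite S" "meets_walks r A B S" "card S < k" by auto
    have sx: "meets_walks (insert (x, y) r) A B (insert x S)"
      and sy: "meets_walks (insert (x, y) r) A B (insert y S)"
      using meets_walks_insert_arc S(2) by metis+
    have "k \<le> card (insert x S)" "k \<le> card (insert y S)"
      using insert.prems(2) sx sy S(1) e by auto
    \<comment> \<open>Since \<open>card S < k\<close>, one added node can reach \<open>k\<close>
      only if it is new and the result has exactly \<open>k\<close> elements.\<close>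
    then have k: "x \<notin> S" "y \<notin> S" "card (insert x S) = k" "card (insert y S) = k" "k > 0"
      using S by (auto simp: card_insert_if split: if_splits)
    have "\<exists>P. linkage r A (insert x S) P \<and> card P = k"
      using insert.prems meets_walks_first[OF sx] e by (intro insert.IH) auto
    then obtain P where P: "linkage r A (insert x S) P" "card P = k" by blast
    obtain p where p: "\<And>s. s \<in> insert x S \<Longrightarrow> p s \<in> P \<and> last (p s) = s"
      using linkage_indexed[OF P k(3) _ k(5)] S(1) by blast
    have "\<exists>Q. linkage r (insert y S) B Q \<and> card Q = k"
      using insert.prems meets_walks_last[OF sy] e S(1) by (intro insert.IH) auto
    then obtain Q where Q: "linkage r (insert y S) B Q" "card Q = k" by blast
    have Q': "linkage (r\<inverse>) B (insert y S) (rev ` Q)" "card (rev ` Q) = k"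
      using linkage_rev[OF Q(1)] Q(2) by (auto simp: card_image)
    obtain q' where q': "\<And>s. s \<in> insert y S \<Longrightarrow> q' s \<in> rev ` Q \<and> last (q' s) = s"
      using linkage_indexed[OF Q' k(4) _ k(5)] S(1) by blast
    define q where "q = rev \<circ> q'"
    have q: "q s \<in> Q \<and> hd (q s) = s" if "s \<in> insert y S" for s
      using q'[OF that] by (auto simp: q_def hd_rev)
    have pw: "walk r A {s} (p s)" "distinct (p s)" if "s \<in> insert x S" for s
      using p[OF that] P(1) by (auto simp: linkage_def walk_def)
    have qw: "walk r {s} B (q s)" "distinct (q s)" if "s \<in> insert y S" for s
      using q[OF that] Q(1) by (auto simp: linkage_def walk_def)
    have pd: "s = t" if "s \<in> insert x S" "t \<in> insert x S" "w \<in> set (p s)" "w \<in> set (p t)" for s t w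
      using that p P(1) unfolding linkage_def by (metis disjoint_iff)
    have qd: "s = t" if "s \<in> insert y S" "t \<in> insert y S" "w \<in> set (q s)" "w \<in> set (q t)" for s t w
      using that q Q(1) unfolding linkage_def by (metis disjoint_iff)
    have ps: "s \<in> set (p s)" if "s \<in> insert x S" for s
      using pw[OF that] by (auto simp: walk_def dest: last_in_set)
    have qs: "s \<in> set (q s)" if "s \<in> insert y S" for s
      using qw[OF that] by (auto simp: walk_def dest: hd_in_set)
    have pS: "w = s" if "s \<in> insert x S" "w \<in> set (p s)" "w \<in> insert x S" for s w
      using pd[of w s w] ps that by blast
    have qS: "w = s" if "s \<in> insert y S" "w \<in> set (q s)" "w \<in> insert y S" for s w
      using qd[of w s w] qs that by blast
    \<comment> \<open>If the two linkages met outside \<open>S\<close>, the initial segment of one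
      walk and the final segment of the other would form a walk in \<open>r\<close> from
      \<open>A\<close> to \<open>B\<close> avoiding \<open>S\<close>.\<close>
    have pq: "w \<in> S"
      if st: "s \<in> insert x S" "t \<in> insert y S" "w \<in> set (p s)" "w \<in> set (q t)" for s t w
    proof (rule ccontr)
      assume w: "w \<notin> S"
      obtain a b where ab: "p s = a @ w # b" using st(3) split_list by fast
      obtain c d where cd: "q t = c @ w # d" using st(4) split_list by fast
      have "set a \<inter> S = {}"
      proof (rule ccontr)
        assume "set a \<inter> S \<noteq> {}"
        then have "s \<in> set a" "s \<in> S" using pS[OF st(1)] ab by fastforce+
        moreover have "s \<in> set (w # b)" using p[OF st(1)] ab by (metis last_appendR last_in_set list.distinct(1))
        ultimately show False using pw(2)[OF st(1)] ab w by auto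
      qed
      moreover have "set d \<inter> S = {}"
      proof (rule ccontr)
        assume "set d \<inter> S \<noteq> {}"
        then have "t \<in> set d" "t \<in> S" using qS[OF st(2)] cd by fastforce+
        moreover have "t \<in> set (c @ [w])" using q[OF st(2)] cd by (cases c) auto
        ultimately show False using qw(2)[OF st(2)] cd w by auto
      qed
      moreover have "walk r A B (a @ w # d)"
        using walk_prefix[of r A "{s}" a w b] walk_suffix[of r "{t}" B c w d]
          pw(1)[OF st(1)] qw(1)[OF st(2)] ab cd by (auto intro: walk_join)
      ultimately show False using S(2) w unfolding meets_walks_def by fastforce
    qed
    \<comment> \<open>The walk ending at \<open>x\<close> continues over the arc to
      \<open>y\<close>; the others are glued at their common node \<open>s\<close>, which
      \<open>tl\<close> keeps from being listed twice.\<close>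
    define h where "h s = (if s = x then p x @ q y else p s @ tl (q s))" for s
    define g where "g s = (if s = x then y else s)" for s
    have g: "g s \<in> insert y S" if "s \<in> insert x S" for s using that by (auto simp: g_def)
    have g_inj: "s = t" if "s \<in> insert x S" "t \<in> insert x S" "g s = g t" for s t
      using that k by (auto simp: g_def split: if_splits)
    have hset: "set (h s) \<subseteq> set (p s) \<union> set (q (g s))" if "s \<in> insert x S" for s
      using set_tl_subset[of "q s"] by (auto simp: h_def g_def)
    have mixed: False if "s \<in> insert x S" "t \<in> insert x S" "s \<noteq> t" "w \<in> set (p s)" "w \<in> set (q (g t))" for s t w
    proof -
      have "w \<in> S" using pq[of s "g t" w] that g by blast
      then have "w = s" "w = g t" using pS[of s w] qS[of "g t" w] that g by blast+
      then show False using that k \<open>w \<in> S\<close> by (auto simp: g_def split: if_splits)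
    qed
    have disj: "set (h s) \<inter> set (h t) = {}" if "s \<in> insert x S" "t \<in> insert x S" "s \<noteq> t" for s t
    proof (rule ccontr)
      assume "set (h s) \<inter> set (h t) \<noteq> {}"
      then obtain w where w: "w \<in> set (h s)" "w \<in> set (h t)" by blast
      have "w \<in> set (p s) \<or> w \<in> set (q (g s))" "w \<in> set (p t) \<or> w \<in> set (q (g t))"
        using hset[OF that(1)] hset[OF that(2)] w by auto
      then show False
        using mixed[OF that, of w] mixed[OF that(2,1) that(3)[symmetric], of w] that(3)
          pd[OF that(1,2), of w] qd[OF g[OF that(1)] g[OF that(2)], of w] g_inj[OF that(1,2)]
        by argo
    qed
    have walk_h: "walk (insert (x, y) r) A B (h s) \<and> distinct (h s)" if s: "s \<in> insert x S" for s
    proof (cases "s = x")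
      case True
      have "set (p x) \<inter> set (q y) = {}"
      proof (rule ccontr)
        assume "set (p x) \<inter> set (q y) \<noteq> {}"
        then obtain w where w: "w \<in> set (p x)" "w \<in> set (q y)" by blast
        then have "w \<in> S" using pq[of x y w] by simp
        then show False using pS[of x w] w k(1) by auto
      qed
      then show ?thesis
        using True pw[of x] qw[of y] walk_mono[of r A "{x}" "p x" "insert (x, y) r"]
          walk_mono[of r "{y}" B "q y" "insert (x, y) r"]
        by (auto simp: h_def walk_def successively_append_iff)
    next
      case False
      then have sS: "s \<in> S" "s \<in> insert y S" using s by auto
      obtain d where d: "q s = s # d" using qw[OF sS(2)] by (cases "q s") (auto simp: walk_def)
      obtain a where a: "p s = a @ [s]"
        using pw[OF s] by (cases "p s" rule: rev_cases) (auto simp: walk_def)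
      have "set (p s) \<inter> set d = {}"
      proof (rule ccontr)
        assume "set (p s) \<inter> set d \<noteq> {}"
        then obtain w where w: "w \<in> set (p s)" "w \<in> set d" by blast
        then have "w \<in> S" using pq[OF s sS(2), of w] d by simp
        then have "w = s" using pS[OF s w(1)] by simp
        then show False using qw(2)[OF sS(2)] d w(2) by simp
      qed
      moreover have "walk r A B (a @ s # d)"
        using pw(1)[OF s] qw(1)[OF sS(2)] a d walk_join[of r A s a B d] by simp
      then have "walk (insert (x, y) r) A B (a @ s # d)" using walk_mono by blast
      ultimately show ?thesis
        using False a d pw(2)[OF s] qw(2)[OF sS(2)] by (auto simp: h_def)
    qed
    have "inj_on h (insert x S)"
    proof (rule inj_onI, rule ccontr)
      fix s t assume "s \<in> insert x S" "t \<in> insert x S" "h s = h t" "s \<noteq> t"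
      then show False using disj[of s t] walk_h[of t] by (auto simp: walk_def)
    qed
    then have "card (h ` insert x S) = k" using k by (metis card_image)
    moreover have "linkage (insert e r) A B (h ` insert x S)"
      unfolding linkage_def e using walk_h disj by blast
    ultimately show ?thesis by blast
  qed
qed

section \<open>Separations by edges\<close>

definition separation :: "'n set \<Rightarrow> ('n \<Rightarrow> 'n \<Rightarrow> bool) \<Rightarrow> 'n set \<Rightarrow> 'n set \<Rightarrow> 'n set \<Rightarrow> bool" where
  "separation N adj A S B \<longleftrightarrow>
     A \<union> S \<union> B = N \<and> A \<inter> S = {} \<and> A \<inter> B = {} \<and> S \<inter> B = {} \<and> (\<forall>a\<in>A. \<forall>b\<in>B. \<not> adj a b)"

text \<open>The subdivided graph: \<open>V\<close> holds the original vertices, \<open>N - V\<close>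
  the edges as nodes of degree two. The last two assumptions are all that is used of uniform
  3-connectedness; Menger's theorem supplies them.\<close>

locale uniform_incidence =
  fixes N V :: "'n set" and adj :: "'n \<Rightarrow> 'n \<Rightarrow> bool"
  assumes finite_N: "finite N"
    and V_subset: "V \<subseteq> N"
    and adj_sym: "adj x y \<Longrightarrow> adj y x"
    and adj_N: "adj x y \<Longrightarrow> x \<in> N"
    and adj_V: "adj x y \<Longrightarrow> x \<in> V \<Longrightarrow> y \<notin> V"
    and edge_ends: "e \<in> N \<Longrightarrow> e \<notin> V \<Longrightarrow>
      \<exists>x y. x \<in> V \<and> y \<in> V \<and> x \<noteq> y \<and> (\<forall>z. adj e z \<longleftrightarrow> z = x \<or> z = y)"
    and card_V: "4 \<le> card V"
    and separation_ge: "separation N adj A S B \<Longrightarrow> x \<in> V \<Longrightarrow> y \<in> V \<Longrightarrow> x \<in> A \<Longrightarrow> y \<in> B \<Longrightarrow> 3 \<le> card S"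
    and separation_ex: "x \<in> V \<Longrightarrow> y \<in> V \<Longrightarrow> x \<noteq> y \<Longrightarrow>
      \<exists>A S B. separation N adj A S B \<and> x \<in> A \<and> y \<in> B \<and> card S = 3"
begin

abbreviation "sep \<equiv> separation N adj"

definition separates :: "'n \<Rightarrow> 'n \<Rightarrow> 'n set \<times> 'n set \<times> 'n set \<Rightarrow> bool" where
  "separates x y = (\<lambda>(A, S, B). sep A S B \<and> x \<in> A \<and> y \<in> B \<and> card S = 3)"

text \<open>Stands in for the presence of a vertex in a corner, which the uncrossing cannot
  guarantee.\<close>

definition two_nbrs :: "'n \<Rightarrow> 'n set \<Rightarrow> bool" where
  "two_nbrs s X \<longleftrightarrow> (\<exists>e\<in>X. \<exists>f\<in>X. e \<noteq> f \<and> adj s e \<and> adj s f)"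

lemma two_nbrs_mono: "two_nbrs s X \<Longrightarrow> (\<And>e. e \<in> X \<Longrightarrow> adj s e \<Longrightarrow> e \<in> Y) \<Longrightarrow> two_nbrs s Y"
  unfolding two_nbrs_def by blast

section \<open>Regions with a boundary of at most two nodes\<close>

lemma adj_N2: "adj x y \<Longrightarrow> y \<in> N"
  using adj_sym adj_N by blast

lemma finite_sub: "X \<subseteq> N \<Longrightarrow> finite X"
  using finite_N finite_subset by blast

lemma sep_sym: "sep A S B \<Longrightarrow> sep B S A"
  unfolding separation_def using adj_sym by blast

lemma sepD:
  assumes "sep A S B"
  shows "A \<subseteq> N" "S \<subseteq> N" "B \<subseteq> N" "A \<inter> S = {}" "A \<inter> B = {}" "S \<inter> B = {}"
    "\<And>x. x \<in> N \<Longrightarrow> x \<in> A \<or> x \<in> S \<or> x \<in> B"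
    "\<And>a b. adj a b \<Longrightarrow> a \<in> A \<Longrightarrow> b \<in> B \<Longrightarrow> False"
    "\<And>a b. adj a b \<Longrightarrow> a \<in> B \<Longrightarrow> b \<in> A \<Longrightarrow> False"
    "\<And>a b. adj a b \<Longrightarrow> a \<in> A \<Longrightarrow> b \<in> A \<or> b \<in> S"
    "\<And>a b. adj a b \<Longrightarrow> a \<in> B \<Longrightarrow> b \<in> B \<or> b \<in> S"
  using assms adj_N2 unfolding separation_def by (blast dest: adj_sym)+

lemma sep_corner:
  assumes "sep A S B" "sep A' S' B'"
  shows "sep (A \<inter> A') (S \<inter> A' \<union> S \<inter> S' \<union> A \<inter> S') (B \<union> B')"
  using assms unfolding separation_def by blast

lemma small_boundary:
  assumes "X \<subseteq> N" "card Z \<le> 2" "finite Z"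
    and nb: "\<And>a b. a \<in> X \<Longrightarrow> adj a b \<Longrightarrow> b \<in> X \<union> Z"
    and "x \<in> V" "x \<in> X" "x \<notin> Z" "y \<in> V" "y \<notin> X" "y \<notin> Z"
  shows False
proof -
  have "sep (X - Z) (Z \<inter> N) (N - X - Z)"
    unfolding separation_def using assms(1) nb by blast
  then have "3 \<le> card (Z \<inter> N)"
    using separation_ge[of "X - Z" "Z \<inter> N" "N - X - Z" x y] assms V_subset by blast
  moreover have "card (Z \<inter> N) \<le> card Z" using assms(3) by (simp add: card_mono)
  ultimately show False using assms(2) by linarith
qed

text \<open>Both parallel edges lie in every separator of their ends, so an order-three separator
  has just one further node \<open>t\<close>. A fourth vertex \<open>w\<close> is then cut off by
  \<open>t\<close> and the end on its own side.\<close>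

lemma no_parallel_edges:
  assumes "adj e x" "adj e y" "adj f x" "adj f y" "x \<in> V" "y \<in> V" "x \<noteq> y" "e \<noteq> f"
  shows False
proof -
  obtain A S B where S: "sep A S B" "x \<in> A" "y \<in> B" "card S = 3"
    using separation_ex assms by blast
  have ef: "e \<notin> V" "f \<notin> V" using assms adj_V adj_sym by blast+
  have "g \<in> S" if "adj g x" "adj g y" for g
    using sepD(7)[OF S(1) adj_N[OF that(1)]] sepD(8)[OF S(1) that(2)] sepD(9)[OF S(1) that(1)] S(2,3)
    by blast
  then have "e \<in> S" "f \<in> S" using assms(1-4) by blast+
  then have "card (S - {e, f}) = 1"
    using S(4) \<open>e \<noteq> f\<close> by (simp add: card_Diff_subset)
  then obtain t where "S - {e, f} = {t}" by (rule card_1_singletonE)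
  then have t: "S \<subseteq> {e, f, t}" by blast
  have "card {x, y, t} < card V"
    using card_V card_insert_le_m1[of 3 "{y, t}" x] card_insert_le_m1[of 2 "{t}" y] by simp
  then have "\<not> V \<subseteq> {x, y, t}" by (meson card_mono finite.emptyI finite_insert not_le)
  then obtain w where w: "w \<in> V" "w \<noteq> x" "w \<noteq> y" "w \<noteq> t" by blast
  have ends: "adj e z \<Longrightarrow> z = x \<or> z = y" "adj f z \<Longrightarrow> z = x \<or> z = y" for z
    using edge_ends[of e] edge_ends[of f] ef assms adj_N by metis+
  have "w \<in> A \<or> w \<in> B" using sepD(7)[OF S(1)] w t ef V_subset by blast
  have side: False
    if A: "sep A S B" "x \<in> A" "y \<in> B" "w \<in> A" and V: "w \<noteq> x" "y \<in> V" "y \<noteq> x" "y \<noteq> t"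
      and ends: "\<And>z. adj e z \<Longrightarrow> z = x \<or> z = y" "\<And>z. adj f z \<Longrightarrow> z = x \<or> z = y" for A B x y
  proof (rule small_boundary[of "A - {x}" "{x, t}" w y])
    fix a b assume a: "a \<in> A - {x}" "adj a b"
    have "b \<noteq> e" "b \<noteq> f"
      using a ends adj_sym sepD(5)[OF A(1)] A(3) by blast+
    then show "b \<in> A - {x} \<union> {x, t}" using sepD(10)[OF A(1) a(2)] a t by blast
  next
    show "y \<notin> A - {x}" using sepD(5)[OF A(1)] A(3) by blast
  qed (use sepD(1)[OF A(1)] A V w in \<open>auto simp: card_insert_if\<close>)
  have xt: "x \<noteq> t" "y \<noteq> t" using S \<open>S - {e, f} = {t}\<close> sepD(4,6)[OF S(1)] by blast+
  from \<open>w \<in> A \<or> w \<in> B\<close> show False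
  proof
    assume "w \<in> A"
    then show False using side[of A B x y] S w assms(5-7) ends xt by simp
  next
    assume "w \<in> B"
    moreover have "adj e z \<Longrightarrow> z = y \<or> z = x" "adj f z \<Longrightarrow> z = y \<or> z = x" for z
      using ends by blast+
    ultimately show False
      using side[of B A y x] S sep_sym[OF S(1)] w assms(5-7) xt by simp
  qed
qed

text \<open>Since \<open>{s, t}\<close> is too small to separate vertices, \<open>X\<close> contains
  no vertex except possibly \<open>t\<close>. So a neighbour of \<open>s\<close> in
  \<open>X\<close>, other than \<open>t\<close>, is an edge from \<open>s\<close> to
  \<open>t\<close>; two of them would be parallel, and \<open>t\<close> cannot be both the far end
  of such an edge and a neighbour of \<open>s\<close>.\<close>

lemma corner:
  assumes "s \<in> V" "s \<notin> X" "X \<subseteq> N"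
    and nb: "\<And>a b. a \<in> X \<Longrightarrow> adj a b \<Longrightarrow> b \<in> X \<union> {s, t}"
    and y: "y \<in> V" "y \<notin> X" "y \<noteq> s" "y \<noteq> t"
    and two: "two_nbrs s (X \<union> {t})"
  shows False
proof -
  have noV: "x \<notin> V" if "x \<in> X" "x \<noteq> t" for x
    using small_boundary[of X "{s, t}" x y] card_insert_le_m1[of 2 "{t}" s] assms that by auto
  obtain e f where ef: "e \<in> X \<union> {t}" "f \<in> X \<union> {t}" "e \<noteq> f" "adj s e" "adj s f"
    using two unfolding two_nbrs_def by blast
  have other: "adj g t \<and> t \<in> V \<and> t \<noteq> s" if g: "g \<in> X" "g \<noteq> t" "adj s g" for g
  proof -
    obtain a b where "a \<in> V" "b \<in> V" "a \<noteq> b" "\<And>z. adj g z \<longleftrightarrow> z = a \<or> z = b"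
      using edge_ends[of g] noV g assms(3) by blast
    then obtain z where z: "adj g z" "z \<noteq> s" "z \<in> V" by metis
    then have "z \<in> X \<union> {s, t}" using nb g by blast
    then show ?thesis using z noV by blast
  qed
  consider "e = t" "f \<in> X" "f \<noteq> t" | "f = t" "e \<in> X" "e \<noteq> t" | "e \<in> X" "e \<noteq> t" "f \<in> X" "f \<noteq> t"
    using ef by blast
  then show False
  proof cases
    case 1 then show False using other[of f] ef adj_V assms(1) by blast
  next
    case 2 then show False using other[of e] ef adj_V assms(1) by blast
  next
    case 3 then show False
      using other[of e] other[of f] ef assms(1) no_parallel_edges[of e s t f] adj_sym by blast
  qed
qed

section \<open>Separators of order three with the fewest vertices\<close>

definition vertex_cost :: "'n \<Rightarrow> 'n \<Rightarrow> nat" where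
  "vertex_cost x y = (LEAST m. \<exists>A S B. separates x y (A, S, B) \<and> card (S \<inter> V) = m)"

lemma vertex_cost_attained:
  assumes "x \<in> V" "y \<in> V" "x \<noteq> y"
  shows "\<exists>A S B. separates x y (A, S, B) \<and> card (S \<inter> V) = vertex_cost x y"
proof -
  have "\<exists>m A S B. separates x y (A, S, B) \<and> card (S \<inter> V) = m"
    using separation_ex[OF assms] by (auto simp: separates_def)
  then show ?thesis unfolding vertex_cost_def by (rule LeastI_ex)
qed

lemma vertex_cost_le: "separates x y (A, S, B) \<Longrightarrow> vertex_cost x y \<le> card (S \<inter> V)"
  unfolding vertex_cost_def by (rule Least_le) blast

lemma separates_sym: "separates x y (A, S, B) \<longleftrightarrow> separates y x (B, S, A)"
  unfolding separates_def using sep_sym by auto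

lemma vertex_cost_sym: "vertex_cost x y = vertex_cost y x"
  unfolding vertex_cost_def separates_sym[of x y] by metis

text \<open>A separator vertex with at most one neighbour in \<open>A\<close> could be exchanged for the edge
  leading there.\<close>

lemma two_nbrs_of_separator_vertex:
  assumes S: "separates x y (A, S, B)" "card (S \<inter> V) = vertex_cost x y"
    and x: "x \<in> V" "y \<in> V" and s: "s \<in> S" "s \<in> V"
  shows "two_nbrs s A"
proof (rule ccontr)
  assume no: "\<not> two_nbrs s A"
  have sp: "sep A S B" "x \<in> A" "y \<in> B" "card S = 3" using S by (auto simp: separates_def)
  have fin: "finite S" using sepD(2)[OF sp(1)] finite_sub by blast
  show False
  proof (cases "\<exists>e\<in>A. adj s e")
    case False
    then have "sep A (S - {s}) (insert s B)"
      using sp(1) s adj_sym unfolding separation_def by blast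
    then have "3 \<le> card (S - {s})" using separation_ge x sp by blast
    then show False using sp(4) s fin by simp
  next
    case True
    then obtain e where e: "e \<in> A" "adj s e" by blast
    then have uniq: "f = e" if "f \<in> A" "adj s f" for f
      using no that unfolding two_nbrs_def by blast
    have eV: "e \<notin> V" using e adj_V s by blast
    have eS: "e \<notin> S" using e sepD(4)[OF sp(1)] by blast
    have "sep (A - {e}) (insert e (S - {s})) (insert s B)"
      using sp(1) s uniq adj_sym e unfolding separation_def by blast
    moreover have "card (insert e (S - {s})) = 3"
      using eS fin sp(4) s by simp
    ultimately have "separates x y (A - {e}, insert e (S - {s}), insert s B)"
      using sp eV x by (auto simp: separates_def)
    then have "vertex_cost x y \<le> card (insert e (S - {s}) \<inter> V)" by (rule vertex_cost_le)
    also have "insert e (S - {s}) \<inter> V = S \<inter> V - {s}" using eV by blast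
    also have "card (S \<inter> V - {s}) < card (S \<inter> V)"
      using fin s by (intro psubset_card_mono) auto
    finally show False using S(2) by simp
  qed
qed

text \<open>Through the region \<open>C1 \<union> C3 \<union> {a}\<close> there are two independent paths from \<open>s\<close> to \<open>q\<close>:
  one enters \<open>q\<close> from \<open>C3\<close>, the other passes through \<open>a\<close> and \<open>C1\<close>.\<close>

lemma two_in_region:
  assumes T: "sep A S B" "s \<in> A" "q \<in> B"
    and V: "s \<in> V" "q \<in> V" "p \<noteq> s" "p \<noteq> q"
    and C: "C1 \<subseteq> N" "C3 \<subseteq> N" "a \<in> N" "C1 \<inter> C3 = {}" "a \<notin> C1" "a \<notin> C3"
    and out: "s \<notin> C1" "s \<notin> C3" "s \<noteq> a" "q \<notin> C1" "q \<notin> C3" "q \<noteq> a"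
    and nb1: "\<And>x z. x \<in> C1 \<Longrightarrow> adj x z \<Longrightarrow> z \<in> C1 \<union> {p, q, a}"
    and nb3: "\<And>x z. x \<in> C3 \<Longrightarrow> adj x z \<Longrightarrow> z \<in> C3 \<union> {s, q, a}"
    and two: "two_nbrs s (C3 \<union> {a})"
    and C1: "C1 \<inter> V \<noteq> {} \<or> a \<in> V \<and> two_nbrs a (C1 \<union> {p})"
    and p: "p \<notin> C1"
  shows "2 \<le> card (S \<inter> (C1 \<union> C3 \<union> {a}))"
proof (rule ccontr)
  define T where "T = S \<inter> (C1 \<union> C3 \<union> {a})"
  assume "\<not> ?thesis"
  then have "card T \<le> 1" unfolding T_def by simp
  moreover have "finite T" unfolding T_def using sepD(2)[OF T(1)] finite_sub by blast
  ultimately have T1: "t = t'" if "t \<in> T" "t' \<in> T" for t t'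
    using that by (metis card_le_Suc0_iff_eq One_nat_def)
  note sd = sepD[OF T(1)]
  have sA: "z \<in> A \<or> z \<in> S" if "adj s z" for z using sd(10) T that by blast
  have qA: "q \<notin> A" "q \<notin> S" using sd(5,6) T by blast+
  \<comment> \<open>In the first two cases \<open>C3 \<inter> A\<close> is bounded by
    \<open>s\<close> and one more node, contrary to \<open>corner\<close>. In the third the only
    node of \<open>T\<close> lies in \<open>C3\<close>, so nothing blocks the way through
    \<open>a\<close> and \<open>C1\<close>.\<close>
  consider "a \<notin> A" | "a \<in> A" "T \<inter> C3 = {}" | "a \<in> A" "T \<inter> C3 \<noteq> {}" by blast
  then show False
  proof cases
    case 1
    obtain t where t: "T \<subseteq> {t}" "t \<noteq> q"
    proof (cases "T = {}")
      \<comment> \<open>With \<open>T\<close> empty any node other than \<open>q\<close> may serve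
        as \<open>t\<close>.\<close>
      case True then show ?thesis using that[of a] out by blast
    next
      case False
      then obtain t where "t \<in> T" by blast
      then show ?thesis using that[of t] T1 out unfolding T_def by blast
    qed
    show False
    proof (rule corner[of s "C3 \<inter> A" t q])
      show "two_nbrs s (C3 \<inter> A \<union> {t})"
        using two by (rule two_nbrs_mono) (use sA t 1 in \<open>auto simp: T_def\<close>)
      show "b \<in> C3 \<inter> A \<union> {s, t}" if "x \<in> C3 \<inter> A" "adj x b" for x b
        using nb3[of x b] sd(10)[OF that(2)] qA that t 1 unfolding T_def by blast
    qed (use V C out t qA T(2) in auto)
  next
    case 2
    show False
    proof (rule corner[of s "C3 \<inter> A" a q])
      show "two_nbrs s (C3 \<inter> A \<union> {a})"
        using two by (rule two_nbrs_mono) (use sA 2 in \<open>auto simp: T_def\<close>)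
      show "b \<in> C3 \<inter> A \<union> {s, a}" if "x \<in> C3 \<inter> A" "adj x b" for x b
        using nb3[of x b] sd(10)[OF that(2)] qA that 2 unfolding T_def by blast
    qed (use V C out qA T(2) in auto)
  next
    case 3
    then obtain t where "t \<in> T" "t \<in> C3" by blast
    then have no: "C1 \<inter> S = {}" using T1[of t] C unfolding T_def by blast
    have aA: "a \<notin> B" "a \<notin> S" using sd(4,5) 3(1) by blast+
    have nbA: "b \<in> C1 \<inter> A \<union> {a, p}" if "x \<in> C1 \<inter> A" "adj x b" for x b
      using nb1[of x b] sd(10)[OF that(2)] qA that no by blast
    have nbB: "b \<in> C1 \<inter> B \<union> {q, p}" if "x \<in> C1 \<inter> B" "adj x b" for x b
      using nb1[of x b] sd(11)[OF that(2)] aA that no by blast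
    \<comment> \<open>As \<open>S\<close> misses \<open>C1\<close>, it splits \<open>C1\<close> into
      two unlinked pieces, bounded by \<open>{a, p}\<close> and \<open>{q, p}\<close>. A vertex in
      either contradicts connectivity; without a vertex in \<open>C1\<close>, the two neighbours of
      \<open>a\<close> contradict \<open>corner\<close>.\<close>
    show False
    proof (cases "C1 \<inter> V = {}")
      case False
      then obtain u where u: "u \<in> C1" "u \<in> V" by blast
      then consider "u \<in> A" | "u \<in> B" using sd(7)[of u] C(1) no by blast
      then show False
      proof cases
        case 1
        show False
        proof (rule small_boundary[OF _ _ _ nbA u(2) _ _ V(2)])
          show "card {a, p} \<le> 2" using card_insert_le_m1[of 2 "{p}" a] by simp
        qed (use u 1 V C out p in auto)
      next
        case 2
        show False
        proof (rule small_boundary[OF _ _ _ nbB u(2) _ _ V(1)])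
          show "card {q, p} \<le> 2" using card_insert_le_m1[of 2 "{p}" q] by simp
        qed (use u 2 V C out p qA T(2) in auto)
      qed
    next
      case True
      then have a: "a \<in> V" "two_nbrs a (C1 \<union> {p})" using C1 by auto
      show False
      proof (rule corner[of a "C1 \<inter> A" p q])
        show "two_nbrs a (C1 \<inter> A \<union> {p})"
        proof (rule two_nbrs_mono[OF a(2)])
          show "e \<in> C1 \<inter> A \<union> {p}" if "e \<in> C1 \<union> {p}" "adj a e" for e
            using sd(10)[OF that(2) 3(1)] that no by blast
        qed
      qed (use nbA a V C out in auto)
    qed
  qed
qed

section \<open>Extremal choice and crossing separations\<close>

lemma card_split3:
  assumes "sep A S B" "X \<subseteq> N"
  shows "card X = card (X \<inter> A) + card (X \<inter> S) + card (X \<inter> B)"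
proof -
  have "X = X \<inter> A \<union> X \<inter> S \<union> X \<inter> B" using assms unfolding separation_def by blast
  then have "card X = card (X \<inter> A \<union> X \<inter> S \<union> X \<inter> B)" by simp
  also have "\<dots> = card (X \<inter> A \<union> X \<inter> S) + card (X \<inter> B)"
    using assms finite_sub[of X] by (intro card_Un_disjoint) (auto simp: separation_def)
  also have "card (X \<inter> A \<union> X \<inter> S) = card (X \<inter> A) + card (X \<inter> S)"
    using assms finite_sub[of X] by (intro card_Un_disjoint) (auto simp: separation_def)
  finally show ?thesis .
qed

lemma max_cost_pair:
  assumes "x \<in> V" "y \<in> V" "x \<noteq> y"
  obtains u v where "u \<in> V" "v \<in> V" "u \<noteq> v" "vertex_cost x y \<le> vertex_cost u v"
    "\<And>w z. w \<in> V \<Longrightarrow> z \<in> V \<Longrightarrow> w \<noteq> z \<Longrightarrow> vertex_cost w z \<le> vertex_cost u v"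
proof -
  define D where "D = {(w, z). w \<in> V \<and> z \<in> V \<and> w \<noteq> z}"
  have "finite D" "D \<noteq> {}"
    using assms finite_sub[OF V_subset] finite_subset[of D "V \<times> V"] by (auto simp: D_def)
  define M where "M = Max (case_prod vertex_cost ` D)"
  have "M \<in> case_prod vertex_cost ` D"
    using \<open>finite D\<close> \<open>D \<noteq> {}\<close> unfolding M_def by (intro Max_in) auto
  then obtain u v where uv: "(u, v) \<in> D" "M = vertex_cost u v" by auto
  have "vertex_cost w z \<le> M" if "(w, z) \<in> D" for w z
    unfolding M_def using that \<open>finite D\<close> by (intro Max_ge) force+
  then show ?thesis using that[of u v] uv assms unfolding D_def by simp
qed

text \<open>The smallest first side breaks ties among cheapest separations, so that uncrossing
  cannot produce an equally cheap one with a properly smaller side.\<close>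

lemma minimal_separation:
  assumes "x \<in> V" "y \<in> V" "x \<noteq> y"
  obtains A S B where "separates x y (A, S, B)" "card (S \<inter> V) = vertex_cost x y"
    "\<And>A' S' B'. separates x y (A', S', B') \<Longrightarrow> card (S' \<inter> V) = vertex_cost x y \<Longrightarrow> card A \<le> card A'"
proof -
  define Q where "Q = (\<lambda>(A, S, B). separates x y (A, S, B) \<and> card (S \<inter> V) = vertex_cost x y)"
  have "\<exists>t. Q t" using vertex_cost_attained[OF assms] unfolding Q_def by simp
  then obtain t where t: "Q t" "\<And>t'. Q t' \<Longrightarrow> (card \<circ> fst) t \<le> (card \<circ> fst) t'"
    using ex_has_least_nat[of Q _ "card \<circ> fst"] by metis
  obtain A S B where "t = (A, S, B)" by (cases t)
  then show ?thesis using that[of A S B] t unfolding Q_def by fastforce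
qed

text \<open>If \<open>v\<close> were in \<open>B'\<close>, the opposite corners would both separate
  \<open>u\<close> from \<open>v\<close>. Their costs add up to at most twice the maximum, so both
  are cheapest; minimality of \<open>A\<close> gives \<open>A \<subseteq> A'\<close>, yet
  \<open>s\<close> in \<open>B'\<close> has a neighbour in \<open>A\<close>.\<close>

lemma crossing_opposite:
  assumes max: "\<And>w z. w \<in> V \<Longrightarrow> z \<in> V \<Longrightarrow> w \<noteq> z \<Longrightarrow> vertex_cost w z \<le> vertex_cost u v"
    and V: "u \<in> V" "v \<in> V" "s \<in> V"
    and S: "separates u v (A, S, B)" "card (S \<inter> V) = vertex_cost u v"
    and min: "\<And>A' S' B'. separates u v (A', S', B') \<Longrightarrow> card (S' \<inter> V) = vertex_cost u v \<Longrightarrow>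
        card A \<le> card A'"
    and s: "s \<in> S" "two_nbrs s A"
    and S': "separates u s (A', S', B')" "card (S' \<inter> V) = vertex_cost u s"
  shows "v \<notin> B'"
proof
  assume v: "v \<in> B'"
  have sp: "sep A S B" "u \<in> A" "v \<in> B" "card S = 3" using S by (auto simp: separates_def)
  have sp': "sep A' S' B'" "u \<in> A'" "s \<in> B'" "card S' = 3" using S' by (auto simp: separates_def)
  define P where "P = S \<inter> A' \<union> S \<inter> S' \<union> A \<inter> S'"
  define Q where "Q = S \<inter> B' \<union> S \<inter> S' \<union> B \<inter> S'"
  have P: "sep (A \<inter> A') P (B \<union> B')" unfolding P_def using sep_corner sp sp' by blast
  have "sep (B \<inter> B') Q (A \<union> A')"
    unfolding Q_def using sep_corner[OF sep_sym sep_sym] sp(1) sp'(1) by (metis Int_commute)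
  then have Q: "sep (A \<union> A') Q (B \<inter> B')" by (rule sep_sym)
  have fin: "finite S" "finite S'" using sepD(2)[OF sp(1)] sepD(2)[OF sp'(1)] finite_sub by auto
  \<comment> \<open>Used with \<open>X = UNIV\<close> for the orders and with \<open>X = V\<close>
    for the costs.\<close>
  have union: "card (P \<inter> X) + card (Q \<inter> X) = card (S \<inter> X) + card (S' \<inter> X)" for X
  proof -
    have "card (P \<inter> X) + card (Q \<inter> X) = card (P \<inter> X \<union> Q \<inter> X) + card (P \<inter> X \<inter> (Q \<inter> X))"
      using fin by (intro card_Un_Int) (auto simp: P_def Q_def)
    also have "P \<inter> X \<union> Q \<inter> X = S \<inter> X \<union> S' \<inter> X"
      using sp(1) sp'(1) unfolding P_def Q_def separation_def by blast
    also have "P \<inter> X \<inter> (Q \<inter> X) = S \<inter> X \<inter> (S' \<inter> X)"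
      using sp(1) sp'(1) unfolding P_def Q_def separation_def by blast
    also have "card (S \<inter> X \<union> S' \<inter> X) + card (S \<inter> X \<inter> (S' \<inter> X)) = card (S \<inter> X) + card (S' \<inter> X)"
      using fin by (intro card_Un_Int[symmetric]) auto
    finally show ?thesis .
  qed
  have "3 \<le> card P" "3 \<le> card Q"
    using separation_ge[OF P, of u v] separation_ge[OF Q, of u v] V sp sp' v by auto
  moreover have "card P + card Q = card S + card S'" using union[of UNIV] by simp
  ultimately have "card P = 3" "card Q = 3" using sp sp' by linarith+
  then have PQ: "separates u v (A \<inter> A', P, B \<union> B')" "separates u v (A \<union> A', Q, B \<inter> B')"
    using P Q sp sp' v by (auto simp: separates_def)
  have "card (P \<inter> V) + card (Q \<inter> V) = card (S \<inter> V) + card (S' \<inter> V)" by (rule union)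
  moreover have "vertex_cost u s \<le> vertex_cost u v"
    using max[of u s] V sepD(5)[OF sp'(1)] sp'(2,3) by blast
  ultimately have "card (P \<inter> V) = vertex_cost u v"
    using vertex_cost_le[OF PQ(1)] vertex_cost_le[OF PQ(2)] S(2) S'(2) by linarith
  then have "card A \<le> card (A \<inter> A')" using min[OF PQ(1)] by blast
  then have "A \<inter> A' = A"
    using finite_sub[OF sepD(1)[OF sp(1)]] by (intro card_seteq) auto
  then have "A \<subseteq> A'" by blast
  moreover obtain e where "e \<in> A" "adj s e" using s unfolding two_nbrs_def by blast
  ultimately show False using sepD(9)[OF sp'(1)] sp'(3) by blast
qed

text \<open>When the two separations cross, all corners have order three, so they cut the graph into
  four pieces arranged cyclically around a hub \<open>q\<close>, which turns out to be joined to \<open>s\<close> by four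
  independent paths.\<close>

lemma crossing_adjacent:
  assumes V: "u \<in> V" "v \<in> V" "s \<in> V"
    and sp: "sep A S B" "u \<in> A" "v \<in> B" "card S = 3"
    and s: "s \<in> S" "two_nbrs s A" "two_nbrs s B"
    and sp': "sep A' S' B'" "u \<in> A'" "s \<in> B'" "card S' = 3"
    and v: "v \<notin> B'" "v \<in> S' \<Longrightarrow> two_nbrs v A'"
  shows False
proof -
  note sd = sepD[OF sp(1)] and sd' = sepD[OF sp'(1)]
  have fin: "finite S" "finite S'" using sd(2) sd'(2) finite_sub by auto
  have neq: "u \<noteq> s" "v \<noteq> s" "u \<noteq> v" using sp s sd sp' sd' by blast+
  have nbrs: "b \<in> X \<inter> Y \<union> (T \<inter> Y \<union> T \<inter> T' \<union> X \<inter> T')"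
    if "sep X T Z" "sep Y T' Z'" "a \<in> X \<inter> Y" "adj a b" for X T Z Y T' Z' a b
    using sepD(10)[OF that(1,4)] sepD(10)[OF that(2,4)] that(3) by blast
  have two_elements: "\<exists>t. Z \<subseteq> {z, t} \<and> t \<in> insert z Z"
    if Z: "card Z \<le> 2" "finite Z" "z \<in> Z" for Z :: "'n set" and z
  proof (cases "Z = {z}")
    case False
    then obtain t where t: "t \<in> Z" "t \<noteq> z" using Z by blast
    have "card {z, t} = 2" using t by simp
    then have "{z, t} = Z" using Z t by (intro card_seteq) auto
    then show ?thesis using t by blast
  qed (use Z in auto)
  \<comment> \<open>The lower bound for a corner in which no vertex is known: a boundary of at most
    two nodes containing \<open>z\<close> is forbidden by the two neighbours of
    \<open>z\<close>.\<close>
  have corner_card: "3 \<le> card (T \<inter> Y) + card (T \<inter> T') + card (X \<inter> T')"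
    if c: "sep X T Z" "sep Y T' Z'" "z \<in> V" "two_nbrs z (X \<inter> Y \<union> (T \<inter> Y \<union> T \<inter> T' \<union> X \<inter> T'))"
      "z \<in> T \<inter> Y \<union> T \<inter> T' \<union> X \<inter> T'" "w \<in> V" "w \<in> Z \<or> w \<in> Z'" for X T Z Y T' Z' z w
  proof (rule ccontr)
    let ?Z = "T \<inter> Y \<union> T \<inter> T' \<union> X \<inter> T'"
    assume "\<not> ?thesis"
    moreover have "card ?Z \<le> card (T \<inter> Y) + card (T \<inter> T') + card (X \<inter> T')"
      by (meson add_mono card_Un_le le_refl order_trans)
    ultimately have "card ?Z \<le> 2" by linarith
    moreover have "finite ?Z" using sepD(2)[OF c(1)] sepD(2)[OF c(2)] finite_sub by blast
    ultimately obtain t where t: "?Z \<subseteq> {z, t}" "t \<in> insert z ?Z" using two_elements c(5) by metis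
    have w: "w \<notin> insert z ?Z" "w \<notin> X \<inter> Y"
      using c(5,7) sepD(4-6)[OF c(1)] sepD(4-6)[OF c(2)] by blast+
    show False
    proof (rule corner[of z "X \<inter> Y" t w])
      show "two_nbrs z (X \<inter> Y \<union> {t})"
        using c(4) by (rule two_nbrs_mono) (use t c(3) adj_V in blast)
      show "b \<in> X \<inter> Y \<union> {z, t}" if "a \<in> X \<inter> Y" "adj a b" for a b
        using nbrs[OF c(1,2) that] t(1) by blast
      show "z \<notin> X \<inter> Y" using c(5) sepD(4)[OF c(1)] sepD(4)[OF c(2)] by blast
      show "w \<noteq> t" using w t by blast
    qed (use w c sepD(1)[OF c(1)] in auto)
  qed
  note sp_s = sep_sym[OF sp(1)] and sp'_s = sep_sym[OF sp'(1)]
  have nA: "e \<in> A \<inter> B' \<union> A \<inter> S'" if "e \<in> A" "adj s e" for e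
    using that sd'(11)[OF that(2) sp'(3)] by blast
  have nB: "e \<in> B \<inter> B' \<union> B \<inter> S'" if "e \<in> B" "adj s e" for e
    using that sd'(11)[OF that(2) sp'(3)] by blast
  have sBB: "s \<in> S \<inter> B'" using s sp' by blast
  have c1: "3 \<le> card (S \<inter> B') + card (S \<inter> S') + card (A \<inter> S')"
  proof (rule corner_card[OF sp(1) sp'_s V(3) _ _ V(1)])
    show "two_nbrs s (A \<inter> B' \<union> (S \<inter> B' \<union> S \<inter> S' \<union> A \<inter> S'))"
      using s(2) by (rule two_nbrs_mono) (use nA in blast)
  qed (use sBB sp' in auto)
  have c2: "3 \<le> card (S \<inter> B') + card (S \<inter> S') + card (B \<inter> S')"
  proof (rule corner_card[OF sp_s sp'_s V(3) _ _ V(1)])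
    show "two_nbrs s (B \<inter> B' \<union> (S \<inter> B' \<union> S \<inter> S' \<union> B \<inter> S'))"
      using s(3) by (rule two_nbrs_mono) (use nB in blast)
  qed (use sBB sp' in auto)
  have c3: "3 \<le> card (S \<inter> A') + card (S \<inter> S') + card (A \<inter> S')"
  proof -
    have "3 \<le> card (S \<inter> A' \<union> S \<inter> S' \<union> A \<inter> S')"
      using separation_ge[OF sep_corner[OF sp(1) sp'(1)], of u s] V sp sp' by blast
    then show ?thesis by (meson add_mono card_Un_le le_refl order_trans)
  qed
  have v': "v \<in> A' \<or> v \<in> S'" using sd'(7) v V V_subset by blast
  have nv: "e \<in> B \<inter> A' \<union> S \<inter> A'" if "e \<in> A'" "adj v e" for e
    using that sd(11)[OF that(2) sp(3)] by blast
  \<comment> \<open>If \<open>v\<close> is in \<open>A'\<close> it lies in this corner. Otherwise it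
    lies on the boundary, in \<open>S'\<close>, and its two neighbours in \<open>A'\<close> take
    over.\<close>
  have c4: "3 \<le> card (S \<inter> A') + card (S \<inter> S') + card (B \<inter> S')"
  proof (cases "v \<in> A'")
    case True
    have "3 \<le> card (S \<inter> A' \<union> S \<inter> S' \<union> B \<inter> S')"
      using separation_ge[OF sep_corner[OF sp_s sp'(1)], of v s] V sp sp' True by blast
    then show ?thesis by (meson add_mono card_Un_le le_refl order_trans)
  next
    case False
    then have vS: "v \<in> S'" using v' by blast
    show ?thesis
    proof (rule corner_card[OF sp_s sp'(1) V(2) _ _ V(3)])
      show "two_nbrs v (B \<inter> A' \<union> (S \<inter> A' \<union> S \<inter> S' \<union> B \<inter> S'))"
        using v(2)[OF vS] by (rule two_nbrs_mono) (use nv in blast)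
    qed (use vS sp sp' in auto)
  qed
  have s1: "card (S \<inter> A') + card (S \<inter> S') + card (S \<inter> B') = 3"
    using card_split3[OF sp'(1) sd(2)] sp(4) by simp
  have s2: "card (A \<inter> S') + card (S \<inter> S') + card (B \<inter> S') = 3"
    using card_split3[OF sp(1) sd'(2)] sp'(4) by (simp add: Int_commute)
  have "card (S \<inter> B') > 0" using sBB fin card_gt_0_iff[of "S \<inter> B'"] by blast
  \<comment> \<open>Summing the inequalities in pairs gives
    \<open>2 * z + y = 2 * x + y = 3\<close>. Besides all ones this admits only
    \<open>y = 3\<close>, the case where the two separators coincide; \<open>s\<close> excludes it
    through \<open>0 < z\<close>.\<close>
  moreover have "x = 1 \<and> y = 1 \<and> z = 1 \<and> r = 1 \<and> t = 1"
    if "3 \<le> z + y + r" "3 \<le> z + y + t" "3 \<le> x + y + r" "3 \<le> x + y + t"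
      "x + y + z = 3" "r + y + t = 3" "0 < z" for x y z r t :: nat
  proof -
    have "z = 1" using that by linarith
    moreover from this have "y = 1" using that by linarith
    ultimately show ?thesis using that by linarith
  qed
  ultimately have "card (S \<inter> A') = 1" "card (S \<inter> S') = 1" "card (S \<inter> B') = 1"
      "card (A \<inter> S') = 1" "card (B \<inter> S') = 1"
    using c1 c2 c3 c4 s1 s2 by blast+
  then obtain p q s' a b where
    pq: "S \<inter> A' = {p}" "S \<inter> S' = {q}" "S \<inter> B' = {s'}" "A \<inter> S' = {a}" "B \<inter> S' = {b}"
    using card_1_singletonE by metis
  then have ss: "S \<inter> B' = {s}" using sBB by simp
  note eq = pq(1,2) ss pq(4,5)
  have nAA: "z \<in> A \<inter> A' \<union> {p, q, a}" if "x \<in> A \<inter> A'" "adj x z" for x z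
    using nbrs[OF sp(1) sp'(1) that, unfolded eq] by blast
  have nAB: "z \<in> A \<inter> B' \<union> {s, q, a}" if "x \<in> A \<inter> B'" "adj x z" for x z
    using nbrs[OF sp(1) sp'_s that, unfolded eq] by blast
  have nBA: "z \<in> B \<inter> A' \<union> {p, q, b}" if "x \<in> B \<inter> A'" "adj x z" for x z
    using nbrs[OF sp_s sp'(1) that, unfolded eq] by blast
  have nBB: "z \<in> B \<inter> B' \<union> {s, q, b}" if "x \<in> B \<inter> B'" "adj x z" for x z
    using nbrs[OF sp_s sp'_s that, unfolded eq] by blast
  have mem: "p \<in> S" "p \<in> A'" "q \<in> S" "q \<in> S'" "a \<in> A" "a \<in> S'" "b \<in> B" "b \<in> S'"
    using eq by (metis Int_iff insertI1)+
  have out: "p \<notin> A" "p \<notin> B" "q \<notin> A" "q \<notin> B" "s \<notin> A" "s \<notin> B" "a \<notin> A'" "a \<notin> B'" "b \<notin> A'" "b \<notin> B'"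
      "p \<noteq> s" "p \<noteq> q" "s \<noteq> q" "s \<noteq> a" "s \<noteq> b" "q \<noteq> a" "q \<noteq> b" "u \<noteq> p" "u \<noteq> a" "u \<noteq> q" "u \<noteq> b"
    using mem s(1) sp sp' sd(4-6) sd'(4-6) by blast+
  have twoA: "two_nbrs s (A \<inter> B' \<union> {a})"
    using s(2) by (rule two_nbrs_mono) (use nA eq in blast)
  have twoB: "two_nbrs s (B \<inter> B' \<union> {b})"
    using s(3) by (rule two_nbrs_mono) (use nB eq in blast)
  \<comment> \<open>Without such a neighbour, \<open>{p, a}\<close> would separate \<open>u\<close>
    from \<open>s\<close>. In the next two corners the two neighbours of \<open>s\<close> play the
    part of \<open>u\<close>.\<close>
  have q1: "\<exists>x\<in>A \<inter> A'. adj q x"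
  proof (rule ccontr)
    assume no: "\<not> ?thesis"
    show False
    proof (rule small_boundary[of "A \<inter> A'" "{p, a}" u s])
      show "z \<in> A \<inter> A' \<union> {p, a}" if "x \<in> A \<inter> A'" "adj x z" for x z
        using nAA[OF that] that no adj_sym by blast
    qed (use V sp sp' out sd(1) in \<open>auto simp: card_insert_if\<close>)
  qed
  have q2: "\<exists>x\<in>A \<inter> B'. adj q x"
  proof (rule ccontr)
    assume no: "\<not> ?thesis"
    show False
    proof (rule corner[of s "A \<inter> B'" a u])
      show "z \<in> A \<inter> B' \<union> {s, a}" if "x \<in> A \<inter> B'" "adj x z" for x z
        using nAB[OF that] that no adj_sym by blast
      show "u \<notin> A \<inter> B'" using sp' sd'(5) by blast
    qed (use V out sd(1) twoA neq in auto)
  qed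
  have q3: "\<exists>x\<in>B \<inter> B'. adj q x"
  proof (rule ccontr)
    assume no: "\<not> ?thesis"
    show False
    proof (rule corner[of s "B \<inter> B'" b u])
      show "z \<in> B \<inter> B' \<union> {s, b}" if "x \<in> B \<inter> B'" "adj x z" for x z
        using nBB[OF that] that no adj_sym by blast
      show "u \<notin> B \<inter> B'" using sp' sd'(5) by blast
    qed (use V out sd(3) twoB neq in auto)
  qed
  \<comment> \<open>An edge has only two ends, but \<open>q\<close> has neighbours in three disjoint
    corners.\<close>
  have qV: "q \<in> V"
  proof (rule ccontr)
    assume "q \<notin> V"
    then obtain x y where "\<And>z. adj q z \<Longrightarrow> z = x \<or> z = y"
      using edge_ends[of q] mem sd(2) by blast
    then show False using q1 q2 q3 sd(5) sd'(5) by (metis Int_iff disjoint_iff)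
  qed
  obtain A2 S2 B2 where S2: "sep A2 S2 B2" "s \<in> A2" "q \<in> B2" "card S2 = 3"
    using separation_ex[of s q] V qV out by blast
  \<comment> \<open>The separator \<open>S2\<close> of \<open>s\<close> and \<open>q\<close> has
    three nodes, but needs two on the \<open>A\<close> side and two on the \<open>B\<close> side,
    which are disjoint.\<close>
  have in_A: "2 \<le> card (S2 \<inter> (A \<inter> A' \<union> A \<inter> B' \<union> {a}))"
  proof (rule two_in_region[OF S2(1-3), where p = p])
    show "A \<inter> A' \<inter> V \<noteq> {} \<or> a \<in> V \<and> two_nbrs a (A \<inter> A' \<union> {p})" using sp sp' V by blast
    show "A \<inter> A' \<inter> (A \<inter> B') = {}" using sd'(5) by blast
  qed (use V qV out mem nAA nAB twoA sd(1) in auto)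
  have in_B: "2 \<le> card (S2 \<inter> (B \<inter> A' \<union> B \<inter> B' \<union> {b}))"
  proof (rule two_in_region[OF S2(1-3), where p = p])
    show "B \<inter> A' \<inter> V \<noteq> {} \<or> b \<in> V \<and> two_nbrs b (B \<inter> A' \<union> {p})"
    proof (cases "v \<in> A'")
      case False
      then have "v = b" "two_nbrs v A'" using v' v(2) sp(3) eq(5) by blast+
      then have "two_nbrs b (B \<inter> A' \<union> {p})"
        using \<open>two_nbrs v A'\<close> two_nbrs_mono[of v A' "B \<inter> A' \<union> S \<inter> A'"] nv eq(1) by simp
      then show ?thesis using \<open>v = b\<close> V by blast
    qed (use sp V in blast)
    show "B \<inter> A' \<inter> (B \<inter> B') = {}" using sd'(5) by blast
  qed (use V qV out mem nBA nBB twoB sd(3) in auto)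
  have "finite S2" using sepD(2)[OF S2(1)] finite_sub by blast
  then have "card (S2 \<inter> A) + card (S2 \<inter> B) \<le> card S2"
    using card_split3[OF sp(1) sepD(2)[OF S2(1)]] by linarith
  moreover have "card (S2 \<inter> (A \<inter> A' \<union> A \<inter> B' \<union> {a})) \<le> card (S2 \<inter> A)"
    using mem \<open>finite S2\<close> by (intro card_mono) auto
  moreover have "card (S2 \<inter> (B \<inter> A' \<union> B \<inter> B' \<union> {b})) \<le> card (S2 \<inter> B)"
    using mem \<open>finite S2\<close> by (intro card_mono) auto
  ultimately show False using in_A in_B S2(4) by linarith
qed

text \<open>At a pair of maximum cost, a separator vertex \<open>s\<close> is contradictory both for
  \<open>v\<close> on the side of \<open>s\<close> and for \<open>v\<close> elsewhere. So the
  maximum cost is zero, and hence every cost.\<close>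

theorem edge_separation:
  assumes "x \<in> V" "y \<in> V" "x \<noteq> y"
  obtains A S B where "sep A S B" "x \<in> A" "y \<in> B" "card S = 3" "S \<inter> V = {}"
proof -
  obtain u v where uv: "u \<in> V" "v \<in> V" "u \<noteq> v" "vertex_cost x y \<le> vertex_cost u v"
    "\<And>w z. w \<in> V \<Longrightarrow> z \<in> V \<Longrightarrow> w \<noteq> z \<Longrightarrow> vertex_cost w z \<le> vertex_cost u v"
    using max_cost_pair[OF assms] by metis
  obtain A S B where S: "separates u v (A, S, B)" "card (S \<inter> V) = vertex_cost u v"
    and min: "\<And>A' S' B'. separates u v (A', S', B') \<Longrightarrow> card (S' \<inter> V) = vertex_cost u v \<Longrightarrow>
      card A \<le> card A'"
    using minimal_separation[OF uv(1-3)] by metis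
  have S_sym: "separates v u (B, S, A)" "card (S \<inter> V) = vertex_cost v u"
    using S separates_sym vertex_cost_sym by metis+
  have sp: "sep A S B" "u \<in> A" "v \<in> B" "card S = 3" using S by (auto simp: separates_def)
  have "S \<inter> V = {}"
  proof (rule ccontr)
    assume "S \<inter> V \<noteq> {}"
    then obtain s where s: "s \<in> S" "s \<in> V" by blast
    have us: "u \<noteq> s" using s sp sepD(4)[OF sp(1)] by blast
    have two: "two_nbrs s A" "two_nbrs s B"
      using two_nbrs_of_separator_vertex[OF S uv(1,2) s]
        two_nbrs_of_separator_vertex[OF S_sym uv(2,1) s] by auto
    obtain A' S' B' where S': "separates u s (A', S', B')" "card (S' \<inter> V) = vertex_cost u s"
      using vertex_cost_attained[OF uv(1) s(2) us] by blast
    have sp': "sep A' S' B'" "u \<in> A'" "s \<in> B'" "card S' = 3" using S' by (auto simp: separates_def)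
    have "v \<notin> B'"
      by (rule crossing_opposite[where u = u and v = v and s = s, OF _ uv(1,2) s(2) S _ s(1) two(1) S'])
        (use uv(5) min in blast)+
    moreover have "two_nbrs v A'" if "v \<in> S'"
      using two_nbrs_of_separator_vertex[OF S' uv(1) s(2) that uv(2)] .
    ultimately show False
      using crossing_adjacent[OF uv(1,2) s(2) sp s(1) two sp'] by blast
  qed
  then have "vertex_cost x y = 0" using S(2) uv(4) by simp
  then obtain A S B where S: "separates x y (A, S, B)" "card (S \<inter> V) = 0"
    using vertex_cost_attained[OF assms] by metis
  then have sp: "sep A S B" "x \<in> A" "y \<in> B" "card S = 3" by (auto simp: separates_def)
  moreover have "S \<inter> V = {}" using S(2) finite_sub[OF sepD(2)[OF sp(1)]] by simp
  ultimately show ?thesis using that by blast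
qed

end

section \<open>Families of 3-edge-cuts\<close>

context uniform_incidence
begin

definition cut :: "'n set \<Rightarrow> 'n set" where
  "cut X = {e \<in> N - V. (\<exists>x\<in>X \<inter> V. adj e x) \<and> (\<exists>y\<in>V - X. adj e y)}"

definition tight :: "'n set \<Rightarrow> bool" where
  "tight X \<longleftrightarrow> X \<subseteq> V \<and> card (cut X) = 3"

lemma finite_cut [simp]: "finite (cut X)"
  unfolding cut_def using finite_N by auto

lemma edge_ends_V:
  assumes "adj e z" "e \<notin> V" shows "z \<in> V"
proof -
  obtain x y where "x \<in> V" "y \<in> V" "\<And>z. adj e z \<longleftrightarrow> z = x \<or> z = y"
    using edge_ends[OF adj_N[OF assms(1)] assms(2)] by blast
  then show ?thesis using assms(1) by auto
qed

text \<open>An edge cut is a separator of the subdivision, with \<open>X\<close> and the edges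
  having all ends in \<open>X\<close> as one side.\<close>

lemma cut_ge:
  assumes "X \<subseteq> V" "x \<in> X" "y \<in> V - X"
  shows "3 \<le> card (cut X)"
proof -
  define A where "A = X \<union> {e \<in> N - V. \<forall>z. adj e z \<longrightarrow> z \<in> X}"
  define B where "B = N - A - cut X"
  have "\<not> adj a b" if "a \<in> A" "b \<in> B" for a b
  proof
    assume ab: "adj a b"
    show False
    proof (cases "a \<in> X")
      case True
      then have "b \<notin> V" "b \<in> N" using ab adj_V assms(1) that(2) by (auto simp: B_def)
      moreover have "adj b a" using ab by (rule adj_sym)
      ultimately have "b \<in> cut X \<or> b \<in> A"
        using True assms(1) edge_ends_V unfolding cut_def A_def by blast
      then show False using that(2) unfolding B_def by blast
    next
      case False
      then show False using that ab unfolding A_def B_def by blast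
    qed
  qed
  moreover have "A \<inter> cut X = {}" "A \<subseteq> N" "cut X \<subseteq> N"
    using assms(1) V_subset unfolding A_def cut_def by blast+
  ultimately have "sep A (cut X) B" unfolding separation_def B_def by blast
  moreover have "x \<in> A" "y \<in> B" using assms V_subset unfolding A_def B_def cut_def by blast+
  ultimately show ?thesis using separation_ge assms by blast
qed

lemma tight_proper:
  assumes "tight X" shows "X \<noteq> {} \<and> X \<noteq> V"
proof -
  have "cut {} = {}" "cut V = {}" by (simp_all add: cut_def)
  then show ?thesis using assms by (auto simp: tight_def)
qed

lemma tight_compl:
  assumes "tight X" shows "tight (V - X)"
proof -
  have X: "X \<subseteq> V" using assms by (simp add: tight_def)
  then have "(V - X) \<inter> V = V - X" "V - (V - X) = X" "X \<inter> V = X" by blast+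
  then have "cut (V - X) = cut X" unfolding cut_def by (simp add: conj_commute)
  then show ?thesis using assms by (simp add: tight_def)
qed

text \<open>A separator without vertices leaves every vertex on one of its sides, and each edge
  joining the sides must belong to it.\<close>

lemma tight_ex:
  assumes "x \<in> V" "y \<in> V" "x \<noteq> y"
  shows "\<exists>Z. tight Z \<and> x \<in> Z \<and> y \<notin> Z"
proof -
  obtain A S B where S: "sep A S B" "x \<in> A" "y \<in> B" "card S = 3" "S \<inter> V = {}"
    using edge_separation[OF assms] by blast
  have y: "y \<notin> A" using S sepD(5)[OF S(1)] by blast
  have "cut (A \<inter> V) \<subseteq> S"
  proof
    fix e assume "e \<in> cut (A \<inter> V)"
    then obtain w z where "e \<in> N" "w \<in> A" "z \<in> V" "z \<notin> A" "adj e w" "adj e z"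
      unfolding cut_def by blast
    moreover from this have "z \<in> B" using S(5) sepD(7)[OF S(1), of z] V_subset by blast
    ultimately show "e \<in> S"
      using sepD(7)[OF S(1), of e] sepD(8)[OF S(1), of e z] sepD(9)[OF S(1), of e w] by blast
  qed
  then have "card (cut (A \<inter> V)) \<le> 3"
    using card_mono[OF finite_sub[OF sepD(2)[OF S(1)]]] S(4) by metis
  moreover have "3 \<le> card (cut (A \<inter> V))"
    using assms S(2) y cut_ge[of "A \<inter> V" x y] by blast
  ultimately have "tight (A \<inter> V)" by (simp add: tight_def)
  then show ?thesis using assms S(2) y by blast
qed

section \<open>Uncrossing tight sets\<close>

lemma cut_submodular: "card (cut (X \<inter> Y)) + card (cut (X \<union> Y)) \<le> card (cut X) + card (cut Y)"
proof -
  have "card (cut (X \<inter> Y)) + card (cut (X \<union> Y))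
      = card (cut (X \<inter> Y) \<union> cut (X \<union> Y)) + card (cut (X \<inter> Y) \<inter> cut (X \<union> Y))"
    by (rule card_Un_Int) auto
  \<comment> \<open>An edge in one of the two new cuts lies in \<open>cut X\<close> or
    \<open>cut Y\<close>; an edge in both runs from \<open>X \<inter> Y\<close> to outside
    \<open>X \<union> Y\<close> and lies in both.\<close>
  also have "\<dots> \<le> card (cut X \<union> cut Y) + card (cut X \<inter> cut Y)"
    by (intro add_mono card_mono) (auto simp: cut_def finite_N)
  also have "\<dots> = card (cut X) + card (cut Y)"
    by (rule card_Un_Int[symmetric]) auto
  finally show ?thesis .
qed

lemma tight_Un:
  assumes "tight X" "tight Y" "X \<inter> Y \<noteq> {}" "y \<in> V" "y \<notin> X" "y \<notin> Y"
  shows "tight (X \<union> Y)"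
proof -
  obtain x where "x \<in> X \<inter> Y" using assms by blast
  then have "3 \<le> card (cut (X \<inter> Y))" "3 \<le> card (cut (X \<union> Y))"
    using assms by (auto intro!: cut_ge[of _ x y] simp: tight_def)
  then show ?thesis using cut_submodular[of X Y] assms by (auto simp: tight_def)
qed

text \<open>Enlarge a tight set by all members of \<open>XX\<close> that it meets. As
  \<open>y\<close> lies in no member, it stays outside and keeps every union proper, which
  \<open>tight_Un\<close> requires.\<close>

lemma tight_laminar_ex:
  assumes X: "\<And>X. X \<in> XX \<Longrightarrow> tight X" "\<And>X Y. X \<in> XX \<Longrightarrow> Y \<in> XX \<Longrightarrow> X \<noteq> Y \<Longrightarrow> X \<inter> Y = {}"
    and xy: "x \<in> V" "y \<in> V - \<Union>XX" "x \<noteq> y"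
  shows "\<exists>Z. tight Z \<and> x \<in> Z \<and> y \<notin> Z \<and> (\<forall>X\<in>XX. X \<subseteq> Z \<or> X \<inter> Z = {})"
proof -
  have "y \<in> V" using xy by blast
  then obtain Z where Z: "tight Z" "x \<in> Z" "y \<notin> Z"
    using tight_ex[OF xy(1) _ xy(3)] by blast
  have "finite XX"
    using X(1) finite_sub[OF V_subset] finite_subset[of XX "Pow V"] by (auto simp: tight_def)
  define YY where "YY = {X \<in> XX. X \<inter> Z \<noteq> {}}"
  have "tight (Z \<union> \<Union>FF)" if "finite FF" "FF \<subseteq> YY" for FF
    using that
  proof (induction FF)
    case empty
    then show ?case using Z by simp
  next
    case (insert X FF)
    have "tight ((Z \<union> \<Union>FF) \<union> X)"
    proof (rule tight_Un[of _ _ y])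
      show "tight (Z \<union> \<Union>FF)" using insert by simp
    qed (use insert.prems X xy Z in \<open>auto simp: YY_def\<close>)
    moreover have "Z \<union> \<Union>(insert X FF) = (Z \<union> \<Union>FF) \<union> X" by auto
    ultimately show ?case by simp
  qed
  then have "tight (Z \<union> \<Union>YY)" using \<open>finite XX\<close> by (simp add: YY_def)
  moreover have "X \<subseteq> Z \<union> \<Union>YY \<or> X \<inter> (Z \<union> \<Union>YY) = {}" if "X \<in> XX" for X
    using that X(2)[OF that] unfolding YY_def by blast
  moreover have "y \<notin> Z \<union> \<Union>YY" using Z xy unfolding YY_def by blast
  ultimately show ?thesis using Z(2) by (intro exI[of _ "Z \<union> \<Union>YY"]) blast
qed

lemma cut_singleton: "x \<in> V \<Longrightarrow> cut {x} = {e. adj x e}"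
proof -
  assume x: "x \<in> V"
  have "e \<in> cut {x}" if "adj x e" for e
  proof -
    have e: "adj e x" "e \<notin> V" using adj_sym[OF that] adj_V[OF that x] by auto
    then have "e \<in> N" by (blast dest: adj_N)
    then obtain y where "y \<in> V" "y \<noteq> x" "adj e y" using edge_ends[of e] e(2) by metis
    then show ?thesis using e x \<open>e \<in> N\<close> unfolding cut_def by blast
  qed
  moreover have "adj x e" if "e \<in> cut {x}" for e
    using that unfolding cut_def by (blast intro: adj_sym)
  ultimately show ?thesis by blast
qed

text \<open>With two edges from \<open>x\<close> into \<open>X\<close>, only one edge
  \<open>h\<close> of the cut is left, so \<open>{x, h}\<close> separates \<open>X\<close> from the
  vertices beyond. Such vertices exist, since otherwise \<open>{x}\<close> would be tight and
  \<open>x\<close> would have degree three.\<close>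

lemma tight_neighbour_once:
  assumes X: "tight X" and x: "x \<in> V" "x \<notin> X" "4 \<le> card {e. adj x e}"
    and e: "adj x e" "adj e y" "y \<in> X" and f: "adj x f" "adj f z" "z \<in> X"
  shows "e = f"
proof (rule ccontr)
  assume "e \<noteq> f"
  have XV: "X \<subseteq> V" and c3: "card (cut X) = 3" using X by (auto simp: tight_def)
  have in_cut: "g \<in> cut X" if "adj x g" "adj g w" "w \<in> X" for g w
  proof -
    have "adj g x" "g \<notin> V" "g \<in> N"
      using adj_sym[OF that(1)] adj_V[OF that(1) x(1)] adj_N2[OF that(1)] by auto
    then show ?thesis using that x(1,2) XV unfolding cut_def by blast
  qed
  have ef: "e \<in> cut X" "f \<in> cut X" using in_cut e f by blast+
  then have "card (cut X - {e, f}) = 1" using c3 \<open>e \<noteq> f\<close> by (simp add: card_Diff_subset)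
  then obtain h where "cut X - {e, f} = {h}" by (rule card_1_singletonE)
  then have h: "cut X \<subseteq> {e, f, h}" "h \<in> cut X" by blast+
  then have hV: "h \<notin> V" unfolding cut_def by blast
  have "X \<noteq> V - {x}"
  proof
    assume "X = V - {x}"
    then have "tight {x}" using tight_compl[OF X] x by (simp add: double_diff)
    then show False using cut_singleton x by (simp add: tight_def)
  qed
  then obtain w where w: "w \<in> V" "w \<noteq> x" "w \<notin> X" using XV x by blast
  have other: "b = x" if g: "adj x g" "adj g v" "v \<in> X" "adj g b" "b \<notin> X" for g v b
  proof -
    have "g \<in> N" "g \<notin> V" using adj_N2[OF g(1)] adj_V[OF g(1) x(1)] by auto
    then obtain c d where "\<And>z. adj g z \<longleftrightarrow> z = c \<or> z = d" using edge_ends[of g] by blast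
    then show ?thesis using g adj_sym[OF g(1)] x(2) by metis
  qed
  \<comment> \<open>The edges \<open>e\<close> and \<open>f\<close> are counted inside, so that
    their outer end \<open>x\<close> is the only boundary node besides \<open>h\<close>.\<close>
  let ?X = "X \<union> {g \<in> N - V. \<exists>z\<in>X. adj g z} - {h}"
  show False
  proof (rule small_boundary[of ?X "{x, h}" y w])
    show "?X \<subseteq> N" using XV V_subset by blast
    show "card {x, h} \<le> 2" using card_insert_le_m1[of 2 "{h}" x] by simp
    fix a b assume a: "a \<in> ?X" "adj a b"
    show "b \<in> ?X \<union> {x, h}"
    proof (cases "a \<in> X")
      case True
      then have "b \<in> N" "b \<notin> V" "adj b a"
        using adj_N2[OF a(2)] adj_V[OF a(2)] adj_sym[OF a(2)] XV by blast+
      then show ?thesis using True by blast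
    next
      case False
      then have g: "a \<in> N" "a \<notin> V" "a \<noteq> h" "\<exists>z\<in>X. adj a z" using a by blast+
      show ?thesis
      proof (cases "b \<in> X")
        case True
        then show ?thesis using hV XV by blast
      next
        case False
        then have "a \<in> cut X" using g a(2) XV edge_ends_V unfolding cut_def by blast
        then have "a = e \<or> a = f" using h(1) g(3) by blast
        then have "adj x a" using e(1) f(1) by blast
        then show ?thesis using other[of a _ b] g(4) a(2) False by blast
      qed
    qed
  qed (use e XV hV w x in auto)
qed

section \<open>Counting the parts of a tight family\<close>

lemma tight_family_card:
  assumes "\<And>X. X \<in> XX \<Longrightarrow> tight X" "\<And>X Y. X \<in> XX \<Longrightarrow> Y \<in> XX \<Longrightarrow> X \<noteq> Y \<Longrightarrow> X \<inter> Y = {}"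
    and "\<And>x. x \<in> V - \<Union>XX \<Longrightarrow> 4 \<le> card {e. adj x e}"
  shows "2 * card (V - \<Union>XX) + 2 \<le> card XX"
  using assms
proof (induction "card (V - \<Union>XX)" arbitrary: XX rule: less_induct)
  case less
  have finV: "finite V" using finite_sub V_subset by blast
  have fin: "finite XX"
    using less.prems(1) finV finite_subset[of XX "Pow V"] by (auto simp: tight_def)
  have finK: "finite (V - \<Union>XX)" using finV by simp
  consider "V - \<Union>XX = {}" | x where "V - \<Union>XX = {x}"
    | x y where "x \<in> V - \<Union>XX" "y \<in> V - \<Union>XX" "x \<noteq> y" by blast
  then show ?case
  proof cases
    case 1
    \<comment> \<open>With no vertex remaining, the parts cover \<open>V\<close>; a tight set is
      proper, so there are at least two.\<close>
    have "V \<noteq> {}" using card_V by auto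
    then obtain X where X: "X \<in> XX" using 1 by blast
    then obtain w where "w \<in> V" "w \<notin> X" using less.prems(1)[OF X] tight_proper unfolding tight_def by blast
    then obtain Y where Y: "Y \<in> XX" "Y \<noteq> X" using 1 by blast
    have "card {X, Y} \<le> card XX" using fin X Y by (intro card_mono) auto
    then show ?thesis unfolding 1 using Y by simp
  next
    case (2 x)
    then have x: "x \<in> V" "x \<notin> \<Union>XX" "4 \<le> card {e. adj x e}" using less.prems(3) by blast+
    have "\<exists>X\<in>XX. \<exists>y\<in>X. adj e y" if "adj x e" for e
    proof -
      have "e \<in> cut {x}" using cut_singleton x that by blast
      then obtain y where "y \<in> V" "y \<noteq> x" "adj e y" unfolding cut_def by blast
      then show ?thesis using 2 by blast
    qed
    then obtain g where g: "\<And>e. adj x e \<Longrightarrow> g e \<in> XX \<and> (\<exists>y\<in>g e. adj e y)" by metis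
    \<comment> \<open>Different edges at \<open>x\<close> lead to different parts, so the degree
      bound four equals \<open>2 * 1 + 2\<close>.\<close>
    have "inj_on g {e. adj x e}"
    proof (rule inj_onI)
      fix e f assume "e \<in> {e. adj x e}" "f \<in> {e. adj x e}" and gg: "g e = g f"
      then have ef: "adj x e" "adj x f" by auto
      obtain y z where "y \<in> g e" "adj e y" "z \<in> g e" "adj f z" using g ef gg by metis
      then show "e = f"
        using tight_neighbour_once[of "g e" x e y f z] less.prems(1) g[OF ef(1)] ef x by blast
    qed
    then have "card {e. adj x e} \<le> card XX" using g fin by (intro card_inj_on_le[of g]) auto
    then show ?thesis using 2 x by simp
  next
    case (3 x y)
    have "\<exists>Z. tight Z \<and> x \<in> Z \<and> y \<notin> Z \<and> (\<forall>X\<in>XX. X \<subseteq> Z \<or> X \<inter> Z = {})"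
    proof (rule tight_laminar_ex)
      show "tight X" if "X \<in> XX" for X using that by (rule less.prems(1))
      show "X \<inter> Y = {}" if "X \<in> XX" "Y \<in> XX" "X \<noteq> Y" for X Y
        using that by (rule less.prems(2))
    qed (use 3 in blast)+
    then obtain Z where Z: "tight Z" "x \<in> Z" "y \<notin> Z" "\<And>X. X \<in> XX \<Longrightarrow> X \<subseteq> Z \<or> X \<inter> Z = {}"
      by blast
    have ZV: "Z \<subseteq> V" using Z by (simp add: tight_def)
    define A where "A = {X \<in> XX. X \<subseteq> Z}"
    define B where "B = {X \<in> XX. X \<inter> Z = {}}"
    have "\<Union>A = \<Union>XX \<inter> Z"
    proof
      show "\<Union>XX \<inter> Z \<subseteq> \<Union>A"
      proof
        fix w assume "w \<in> \<Union>XX \<inter> Z"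
        then obtain X where X: "X \<in> XX" "w \<in> X" "w \<in> Z" by blast
        then have "X \<subseteq> Z" using Z(4)[OF X(1)] by blast
        then show "w \<in> \<Union>A" using X unfolding A_def by blast
      qed
    qed (auto simp: A_def)
    then have K1: "V - \<Union>(insert (V - Z) A) = (V - \<Union>XX) \<inter> Z"
      using ZV by auto
    have "\<Union>B = \<Union>XX - Z"
    proof
      show "\<Union>XX - Z \<subseteq> \<Union>B"
      proof
        fix w assume "w \<in> \<Union>XX - Z"
        then obtain X where X: "X \<in> XX" "w \<in> X" "w \<notin> Z" by blast
        then have "X \<inter> Z = {}" using Z(4)[OF X(1)] by blast
        then show "w \<in> \<Union>B" using X unfolding B_def by blast
      qed
    qed (auto simp: B_def)
    then have K2: "V - \<Union>(insert Z B) = (V - \<Union>XX) - Z"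
      by auto
    \<comment> \<open>The far side of the cut acts as a single part. The two induction bounds add up
      to \<open>2 * h + 4\<close>, and the two new parts account for the surplus of two.\<close>
    have "2 * card (V - \<Union>(insert (V - Z) A)) + 2 \<le> card (insert (V - Z) A)"
    proof (rule less.hyps)
      show "card (V - \<Union>(insert (V - Z) A)) < card (V - \<Union>XX)"
        unfolding K1 using 3 Z finK by (intro psubset_card_mono) auto
      show "tight X" if "X \<in> insert (V - Z) A" for X
        using that tight_compl[OF Z(1)] less.prems(1) unfolding A_def by blast
      show "X \<inter> Y = {}" if "X \<in> insert (V - Z) A" "Y \<in> insert (V - Z) A" "X \<noteq> Y" for X Y
        using that less.prems(2)[of X Y] unfolding A_def by blast
      show "4 \<le> card {e. adj w e}" if "w \<in> V - \<Union>(insert (V - Z) A)" for w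
        using that less.prems(3) unfolding K1 by blast
    qed
    moreover have "2 * card (V - \<Union>(insert Z B)) + 2 \<le> card (insert Z B)"
    proof (rule less.hyps)
      show "card (V - \<Union>(insert Z B)) < card (V - \<Union>XX)"
        unfolding K2 using 3 Z finK by (intro psubset_card_mono) auto
      show "tight X" if "X \<in> insert Z B" for X
        using that Z(1) less.prems(1) unfolding B_def by blast
      show "X \<inter> Y = {}" if "X \<in> insert Z B" "Y \<in> insert Z B" "X \<noteq> Y" for X Y
        using that less.prems(2)[of X Y] unfolding B_def by blast
      show "4 \<le> card {e. adj w e}" if "w \<in> V - \<Union>(insert Z B)" for w
        using that less.prems(3) unfolding K2 by blast
    qed
    moreover have "card (insert (V - Z) A) \<le> Suc (card A)" "card (insert Z B) \<le> Suc (card B)"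
      by (rule card_insert_le_m1; simp)+
    moreover have "card A + card B \<le> card XX"
    proof -
      have "A \<inter> B = {}"
        using less.prems(1) tight_proper unfolding A_def B_def by (auto simp: inf_absorb1)
      then have "card A + card B = card (A \<union> B)"
        using fin by (intro card_Un_disjoint[symmetric]) (auto simp: A_def B_def)
      also have "\<dots> \<le> card XX" using fin by (intro card_mono) (auto simp: A_def B_def)
      finally show ?thesis .
    qed
    moreover have "card (V - \<Union>XX) = card ((V - \<Union>XX) \<inter> Z) + card ((V - \<Union>XX) - Z)"
      using finK card_Int_Diff by blast
    ultimately show ?thesis unfolding K1 K2 by linarith
  qed
qed

lemma degree_ge:
  assumes "x \<in> V"
  shows "3 \<le> card {e. adj x e}"
proof -
  have "V \<noteq> {x}" using card_V by auto
  then obtain y where "y \<in> V - {x}" using assms by blast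
  then show ?thesis using cut_ge[of "{x}" x y] cut_singleton assms by simp
qed

text \<open>The singletons of degree-three vertices are disjoint tight sets, and every vertex
  outside them has degree at least four.\<close>

theorem degree_three_count:
  "2 * card {x \<in> V. card {e. adj x e} \<noteq> 3} + 2 \<le> card {x \<in> V. card {e. adj x e} = 3}"
proof -
  define XX where "XX = (\<lambda>x. {x}) ` {x \<in> V. card {e. adj x e} = 3}"
  have K: "V - \<Union>XX = {x \<in> V. card {e. adj x e} \<noteq> 3}" by (auto simp: XX_def)
  have "2 * card (V - \<Union>XX) + 2 \<le> card XX"
  proof (rule tight_family_card)
    show "tight X" if "X \<in> XX" for X
      using that cut_singleton by (auto simp: XX_def tight_def)
    show "4 \<le> card {e. adj x e}" if "x \<in> V - \<Union>XX" for x
    proof -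
      have x: "x \<in> V" "card {e. adj x e} \<noteq> 3" using that unfolding K by auto
      then show ?thesis using degree_ge[of x] by simp
    qed
  qed (auto simp: XX_def)
  moreover have "card XX = card {x \<in> V. card {e. adj x e} = 3}"
    unfolding XX_def by (simp add: card_image)
  ultimately show ?thesis unfolding K by simp
qed

end

section \<open>Uniformly 3-connected multigraphs\<close>

fun incident :: "('v, 'e) multigraph \<Rightarrow> 'v + 'e \<Rightarrow> 'v + 'e \<Rightarrow> bool" where
  "incident G (Inl v) (Inr e) \<longleftrightarrow> e \<in> edges G \<and> v \<in> ends G e"
| "incident G (Inr e) (Inl v) \<longleftrightarrow> e \<in> edges G \<and> v \<in> ends G e"
| "incident G _ _ \<longleftrightarrow> False"

definition nodes :: "('v, 'e) multigraph \<Rightarrow> ('v + 'e) set" where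
  "nodes G = Inl ` verts G \<union> Inr ` edges G"

lemma incident_sym: "incident G x y \<Longrightarrow> incident G y x"
  by (cases x; cases y) auto

lemma incident_Inl: "incident G (Inl v) y \<longleftrightarrow> (\<exists>e. y = Inr e \<and> e \<in> edges G \<and> v \<in> ends G e)"
  by (cases y) auto

section \<open>A separator bounds the number of independent paths\<close>

lemma path_meets_separator:
  assumes S: "separation (nodes G) (incident G) A S B"
    and p: "p \<in> paths_between G u v" "Inl u \<in> A" "Inl v \<in> B"
  shows "\<exists>n\<in>S. n \<in> Inl ` path_verts p \<union> Inr ` set (snd p)"
proof (rule ccontr)
  assume no: "\<not> ?thesis"
  obtain ws es where pe: "p = (ws, es)" by fastforce
  have ws: "length ws = Suc (length es)" "set ws \<subseteq> verts G" "set es \<subseteq> edges G" "hd ws = u" "last ws = v"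
      "\<And>i. i < length es \<Longrightarrow> ends G (es ! i) = {ws ! i, ws ! Suc i}"
    using p(1) by (auto simp: paths_between_def is_path_def pe)
  \<comment> \<open>A path avoiding \<open>S\<close> can never leave \<open>A\<close>: the edge
    after a vertex in \<open>A\<close> is again in \<open>A\<close>, and so is the next
    vertex.\<close>
  have "Inl (ws ! i) \<in> A" if "i < length ws" for i
    using that
  proof (induction i)
    case 0
    then show ?case using ws p(2) by (metis hd_conv_nth length_greater_0_conv)
  next
    case (Suc i)
    then have i: "i < length es" using ws(1) by simp
    then have e: "es ! i \<in> edges G" using ws(3) by auto
    have "Inr (es ! i) \<notin> S" using no i by (auto simp: pe)
    moreover have "incident G (Inl (ws ! i)) (Inr (es ! i))"
      "incident G (Inr (es ! i)) (Inl (ws ! Suc i))" using e ws(6)[OF i] by auto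
    moreover have "Inr (es ! i) \<in> nodes G" "Inl (ws ! Suc i) \<in> nodes G"
      using e ws(2) nth_mem[OF Suc.prems] by (auto simp: nodes_def)
    moreover have "Inl (ws ! Suc i) \<notin> S" using no Suc.prems by (auto simp: pe path_verts_def)
    moreover have "Inl (ws ! i) \<in> A" using Suc by simp
    ultimately show ?case using S unfolding separation_def by blast
  qed
  then have "Inl v \<in> A" using ws(1,5) by (metis last_conv_nth length_0_conv lessI diff_Suc_1 nat.distinct(1))
  then show False using S p(3) unfolding separation_def by blast
qed

text \<open>Independence restricts only shared vertices. This rules out shared edges as well: the
  ends of a shared edge would be \<open>u\<close> and \<open>v\<close>, and both paths would be that
  single edge.\<close>

lemma edge_with_end_vertices:
  assumes p: "p \<in> paths_between G u v" and i: "i < length (snd p)"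
    and e: "ends G (snd p ! i) \<subseteq> {u, v}" and uv: "u \<noteq> v"
  shows "p = ([u, v], [snd p ! i])"
proof -
  obtain ws es where pe: "p = (ws, es)" by fastforce
  have ws: "length ws = Suc (length es)" "distinct ws" "hd ws = u" "last ws = v"
    using p by (auto simp: paths_between_def is_path_def pe)
  have i: "i < length es" using i by (simp add: pe)
  then have "ends G (es ! i) = {ws ! i, ws ! Suc i}"
    using p by (auto simp: paths_between_def is_path_def pe)
  then have mem: "ws ! i \<in> {u, v}" "ws ! Suc i \<in> {u, v}" using e by (auto simp: pe)
  have hl: "ws ! 0 = u" "ws ! length es = v"
    using ws by (metis hd_conv_nth length_0_conv nat.distinct(1),
        metis last_conv_nth length_0_conv nat.distinct(1) diff_Suc_1)
  have "ws ! i \<noteq> v" using hl(2) ws(1,2) i by (metis less_Suc_eq less_irrefl nth_eq_iff_index_eq)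
  then have "ws ! i = ws ! 0" using mem hl by auto
  then have i0: "i = 0" using ws(1,2) i by (simp add: nth_eq_iff_index_eq)
  have "ws ! Suc i \<noteq> u"
    using hl(1) ws(1,2) i nth_eq_iff_index_eq[of ws "Suc i" 0] by auto
  then have "ws ! Suc i = ws ! length es" using mem hl by auto
  then have "Suc i = length es" using ws(1,2) i by (simp add: nth_eq_iff_index_eq)
  then have len: "length es = 1" "length ws = 2" using i0 ws(1) by auto
  then obtain e a b where "es = [e]" "ws = [a, b]"
    by (auto simp: length_Suc_conv numeral_2_eq_2)
  then show ?thesis using ws i0 by (simp add: pe)
qed

lemma independent_paths_card_le:
  assumes G: "fin_multigraph G" and S: "separation (nodes G) (incident G) A S B"
    and uv: "Inl u \<in> A" "Inl v \<in> B" and P: "P \<subseteq> paths_between G u v" "independent_paths P"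
  shows "card P \<le> card S"
proof -
  have "finite (nodes G)"
    using G by (simp add: nodes_def fin_multigraph.finite_verts fin_multigraph.finite_edges)
  moreover have "S \<subseteq> nodes G" using S unfolding separation_def by blast
  ultimately have finS: "finite S" by (rule rev_finite_subset)
  have neq: "u \<noteq> v" using S uv unfolding separation_def by blast
  have notS: "Inl u \<notin> S" "Inl v \<notin> S" using S uv unfolding separation_def by blast+
  have "\<forall>p\<in>P. \<exists>n\<in>S. n \<in> Inl ` path_verts p \<union> Inr ` set (snd p)"
    using path_meets_separator[OF S _ uv] P(1) by blast
  then obtain f where f: "\<And>p. p \<in> P \<Longrightarrow> f p \<in> S \<and> f p \<in> Inl ` path_verts p \<union> Inr ` set (snd p)"
    by metis
  have shared: "w \<in> {u, v}" if "p \<in> P" "q \<in> P" "p \<noteq> q" "w \<in> path_verts p" "w \<in> path_verts q" for p q w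
  proof -
    have "w \<in> path_endpoints p" using that P(2) unfolding independent_paths_def by metis
    moreover have "p \<in> paths_between G u v" using that(1) P(1) by blast
    ultimately show ?thesis by (simp add: paths_between_def path_endpoints_def)
  qed
  have single: "p = ([u, v], [e])"
    if "p \<in> P" "e \<in> set (snd p)" "ends G e \<subseteq> {u, v}" for p e
  proof -
    obtain i where i: "i < length (snd p)" "snd p ! i = e" using \<open>e \<in> _\<close> by (meson in_set_conv_nth)
    have "p \<in> paths_between G u v" using that(1) P(1) by blast
    then show ?thesis using edge_with_end_vertices[of p G u v i] i neq that(3) by simp
  qed
  have on_path: "ends G e \<subseteq> path_verts p" if p: "p \<in> P" "e \<in> set (snd p)" for p e
  proof -
    obtain i where i: "i < length (snd p)" "snd p ! i = e" using p(2) by (meson in_set_conv_nth)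
    have "is_path G p" using p P by (auto simp: paths_between_def)
    then have "ends G e = {fst p ! i, fst p ! Suc i}" "length (fst p) = Suc (length (snd p))"
      using i by (auto simp: is_path_def)
    then show ?thesis using i by (simp add: path_verts_def)
  qed
  have "inj_on f P"
  proof (rule inj_onI, rule ccontr)
    fix p q assume pq: "p \<in> P" "q \<in> P" "f p = f q" "p \<noteq> q"
    show False
    proof (cases "f p")
      case (Inl w)
      then have "w \<in> path_verts p" "w \<in> path_verts q" using f[OF pq(1)] f[OF pq(2)] pq(3) by auto
      then have "w \<in> {u, v}" using shared pq by blast
      then show False using f[OF pq(1)] Inl notS by auto
    next
      case (Inr e)
      then have e: "e \<in> set (snd p)" "e \<in> set (snd q)"
        using f[OF pq(1)] f[OF pq(2)] pq(3) by auto
      then have "ends G e \<subseteq> {u, v}" using shared[OF pq(1,2,4)] on_path pq by blast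
      then show False using single[OF pq(1) e(1)] single[OF pq(2) e(2)] pq(4) by simp
    qed
  qed
  then show ?thesis using f finS by (intro card_inj_on_le[of f]) auto
qed

section \<open>From walks in the subdivision to paths of the multigraph\<close>

fun lefts :: "('a + 'b) list \<Rightarrow> 'a list" where
  "lefts [] = []"
| "lefts (Inl a # xs) = a # lefts xs"
| "lefts (Inr b # xs) = lefts xs"

fun rights :: "('a + 'b) list \<Rightarrow> 'b list" where
  "rights [] = []"
| "rights (Inl a # xs) = rights xs"
| "rights (Inr b # xs) = b # rights xs"

lemma set_lefts: "set (lefts xs) = {x. Inl x \<in> set xs}"
  by (induction xs rule: lefts.induct) auto

lemma set_rights: "set (rights xs) = {x. Inr x \<in> set xs}"
  by (induction xs rule: rights.induct) auto

lemma distinct_lefts: "distinct xs \<Longrightarrow> distinct (lefts xs)"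
  by (induction xs rule: lefts.induct) (auto simp: set_lefts)

lemma lefts_append: "lefts (xs @ ys) = lefts xs @ lefts ys"
  by (induction xs rule: lefts.induct) auto

lemma rights_append: "rights (xs @ ys) = rights xs @ rights ys"
  by (induction xs rule: rights.induct) auto

lemma alternating_walk:
  assumes "fin_multigraph G" "successively (incident G) xs" "distinct xs" "xs \<noteq> []"
    "hd xs = Inl a" "last xs = Inl b"
  shows "length (lefts xs) = Suc (length (rights xs)) \<and> hd (lefts xs) = a \<and> last (lefts xs) = b \<and>
    (\<forall>i < length (rights xs). ends G (rights xs ! i) = {lefts xs ! i, lefts xs ! Suc i})"
  using assms(2-)
proof (induction xs arbitrary: a rule: induct_list012)
  case (3 x y zs)
  then obtain e where y: "x = Inl a" "y = Inr e" "e \<in> edges G" "a \<in> ends G e"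
    by (cases y) auto
  then obtain z zs' where zs: "zs = z # zs'" using 3 by (cases zs) auto
  then obtain c where z: "z = Inl c" "c \<in> ends G e" using 3 y by (cases z) auto
  have IH: "length (lefts zs) = Suc (length (rights zs)) \<and> hd (lefts zs) = c \<and> last (lefts zs) = b \<and>
    (\<forall>i < length (rights zs). ends G (rights zs ! i) = {lefts zs ! i, lefts zs ! Suc i})"
    using 3 zs z by (intro "3.IH"(1)) auto
  \<comment> \<open>Distinctness keeps the walk from turning back at the edge \<open>e\<close>, so
    both ends of \<open>e\<close> are visited.\<close>
  have "a \<noteq> c" using 3 y zs z by auto
  then have "{a, c} = ends G e"
    using y z fin_multigraph.card_ends[OF assms(1) y(3)]
    by (intro card_seteq) (auto intro: card_ge_0_finite)
  then show ?case using IH y zs z by (auto simp: nth_Cons split: nat.splits)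
qed auto

context fin_multigraph
begin

lemma finite_nodes: "finite (nodes G)"
  by (simp add: nodes_def finite_verts finite_edges)

lemma incident_nodes: "incident G x y \<Longrightarrow> x \<in> nodes G"
  using ends_in_verts by (cases x; cases y) (auto simp: nodes_def)

lemma incident_nodes2: "incident G x y \<Longrightarrow> y \<in> nodes G"
  by (rule incident_nodes[OF incident_sym])

lemma paths_of_linkage:
  assumes uv: "u \<in> verts G" "v \<in> verts G" "u \<noteq> v"
    and P: "linkage {(x, y). incident G x y \<and> {x, y} \<inter> {Inl u, Inl v} = {}}
      {n. incident G (Inl u) n} {n. incident G (Inl v) n} P"
  obtains Q where "Q \<subseteq> paths_between G u v" "independent_paths Q" "card Q = card P"
proof -
  define c where "c xs = (u # lefts xs @ [v], rights xs)" for xs :: "('v + 'e) list"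
  let ?r = "{(x, y). incident G x y \<and> {x, y} \<inter> {Inl u, Inl v} = {}}"
  have p: "c xs \<in> paths_between G u v" "rights xs \<noteq> []" if "xs \<in> P" for xs
  proof -
    have w: "walk ?r {n. incident G (Inl u) n} {n. incident G (Inl v) n} xs" "distinct xs"
      using P that by (auto simp: linkage_def)
    have step: "successively (\<lambda>x y. (x, y) \<in> ?r) xs" "xs \<noteq> []"
        "incident G (Inl u) (hd xs)" "incident G (Inl v) (last xs)"
      using w(1) by (auto simp: walk_def)
    \<comment> \<open>The first node is an edge at \<open>u\<close>, and no arc of \<open>?r\<close>
      touches \<open>u\<close> or \<open>v\<close>, so neither can appear later.\<close>
    have avoid: "Inl u \<notin> set xs \<and> Inl v \<notin> set xs"
    proof -
      have "Inl u \<notin> set (z # zs) \<and> Inl v \<notin> set (z # zs)"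
        if "successively (\<lambda>x y. (x, y) \<in> ?r) (z # zs)" "z \<noteq> Inl u" "z \<noteq> Inl v" for z zs
        using that by (induction zs arbitrary: z) auto
      moreover obtain z zs where "xs = z # zs" using step(2) by (cases xs) auto
      ultimately show ?thesis using step(1,3) by (auto simp: incident_Inl)
    qed
    have succ: "successively (incident G) xs" using step(1) by (rule successively_mono) auto
    let ?xs = "Inl u # xs @ [Inl v]"
    have "successively (incident G) (xs @ [Inl v])"
      using succ incident_sym[OF step(4)] by (simp add: successively_append_iff)
    then have succ': "successively (incident G) ?xs" using step(2,3) by (simp add: successively_Cons hd_append)
    have dist: "distinct ?xs" using w(2) avoid uv(3) by auto
    have alt: "length (lefts ?xs) = Suc (length (rights ?xs))" "hd (lefts ?xs) = u"
        "last (lefts ?xs) = v" "distinct (lefts ?xs)"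
        "\<forall>i < length (rights ?xs). ends G (rights ?xs ! i) = {lefts ?xs ! i, lefts ?xs ! Suc i}"
      using alternating_walk[OF fin_multigraph_axioms succ' dist, of u v] distinct_lefts[OF dist]
      by simp_all
    have "set xs \<subseteq> nodes G"
    proof
      fix x assume "x \<in> set xs"
      have "successively (incident G) (Inl u # xs)"
        using succ step(2,3) by (cases xs) auto
      then have "set zs \<subseteq> nodes G" if "successively (incident G) (z # zs)" for z zs
        using that by (induction zs arbitrary: z) (auto dest: incident_sym incident_nodes)
      then show "x \<in> nodes G" using \<open>x \<in> set xs\<close> \<open>successively (incident G) (Inl u # xs)\<close> by blast
    qed
    then have "set (lefts ?xs) \<subseteq> verts G" "set (rights ?xs) \<subseteq> edges G"
      using uv by (auto simp: nodes_def set_lefts set_rights)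
    then show "c xs \<in> paths_between G u v"
      using alt by (simp add: c_def paths_between_def is_path_def lefts_append rights_append)
    show "rights xs \<noteq> []"
      using step(2,3) by (cases xs) (auto simp: incident_Inl)
  qed
  have disj: "set xs \<inter> set ys = {}" if "xs \<in> P" "ys \<in> P" "xs \<noteq> ys" for xs ys
    using P that by (auto simp: linkage_def)
  have "inj_on c P"
  proof (rule inj_onI, rule ccontr)
    fix xs ys assume xy: "xs \<in> P" "ys \<in> P" "c xs = c ys" "xs \<noteq> ys"
    then have "rights xs = rights ys" by (simp add: c_def)
    \<comment> \<open>Edges tell the paths apart: parallel edges from \<open>u\<close> to
      \<open>v\<close> give paths with the same vertex sequence.\<close>
    then obtain e where "e \<in> set (rights xs)" "e \<in> set (rights ys)" using p(2)[OF xy(1)] by fastforce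
    then show False using disj[OF xy(1,2,4)] by (auto simp: set_rights)
  qed
  then have "card (c ` P) = card P" by (rule card_image)
  moreover have "independent_paths (c ` P)"
    unfolding independent_paths_def
  proof (intro allI impI ballI)
    fix w p'
    assume "\<exists>p\<in>c ` P. \<exists>q\<in>c ` P. p \<noteq> q \<and> w \<in> path_verts p \<and> w \<in> path_verts q"
    then obtain xs ys where "xs \<in> P" "ys \<in> P" "xs \<noteq> ys" "w \<in> path_verts (c xs)" "w \<in> path_verts (c ys)"
      by blast
    then have "w \<in> {u, v}" using disj[of xs ys] by (auto simp: c_def path_verts_def set_lefts)
    moreover assume "p' \<in> c ` P"
    ultimately show "w \<in> path_endpoints p'" by (auto simp: c_def path_endpoints_def)
  qed
  ultimately show ?thesis using that[of "c ` P"] p(1) by blast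
qed

text \<open>Menger's theorem is applied between the neighbourhoods of \<open>u\<close> and
  \<open>v\<close>. An edge joining them lies in both neighbourhoods and is a one-node walk, so
  adjacency needs no special treatment.\<close>

lemma separation_or_paths:
  assumes uv: "u \<in> verts G" "v \<in> verts G" "u \<noteq> v"
  shows "(\<exists>A S B. separation (nodes G) (incident G) A S B \<and> Inl u \<in> A \<and> Inl v \<in> B \<and> card S < k) \<or>
    (\<exists>P. P \<subseteq> paths_between G u v \<and> independent_paths P \<and> card P = k)"
proof (rule disjCI)
  assume no: "\<not> (\<exists>P. P \<subseteq> paths_between G u v \<and> independent_paths P \<and> card P = k)"
  let ?r = "{(x, y). incident G x y \<and> {x, y} \<inter> {Inl u, Inl v} = {}}"
  let ?A = "{n. incident G (Inl u) n}" and ?B = "{n. incident G (Inl v) n}"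
  have "\<not> (\<exists>P. linkage ?r ?A ?B P \<and> card P = k)"
  proof
    assume "\<exists>P. linkage ?r ?A ?B P \<and> card P = k"
    then obtain P where P: "linkage ?r ?A ?B P" "card P = k" by blast
    obtain Q where "Q \<subseteq> paths_between G u v" "independent_paths Q" "card Q = card P"
      by (rule paths_of_linkage[OF uv P(1)])
    then show False using no P(2) by metis
  qed
  moreover have "?r \<subseteq> nodes G \<times> nodes G" "?A \<subseteq> nodes G"
    by (auto dest: incident_nodes incident_nodes2)
  then have "finite ?r" "finite ?A"
    using finite_nodes finite_subset by (blast intro: finite_cartesian_product)+
  ultimately obtain S where S: "finite S" "meets_walks ?r ?A ?B S" "card S < k"
    using menger[of ?r ?A ?B k] not_le by blast
  \<comment> \<open>\<open>R\<close> is what can be reached from \<open>u\<close> without meeting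
    \<open>S\<close>. These walks consist of nodes other than \<open>u\<close> and \<open>v\<close>,
    so trimming \<open>S\<close> to \<open>S'\<close> opens no new way.\<close>
  define R where "R = insert (Inl u) {n. \<exists>xs. walk ?r ?A {n} xs \<and> set xs \<inter> S = {}}"
  define S' where "S' = S \<inter> nodes G - {Inl u, Inl v}"
  define B where "B = nodes G - R - S'"
  have walk_last: "n \<in> nodes G" "n \<noteq> Inl u" "n \<noteq> Inl v" if "walk ?r ?A {n} xs" for n xs
  proof -
    have "n \<in> nodes G \<and> n \<noteq> Inl u \<and> n \<noteq> Inl v"
    proof (cases xs rule: rev_cases)
      case (snoc ys y)
      then show ?thesis
        using that
        by (cases ys rule: rev_cases)
          (auto simp: walk_def successively_append_iff incident_Inl nodes_def dest: incident_nodes2)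
    qed (use that in \<open>auto simp: walk_def\<close>)
    then show "n \<in> nodes G" "n \<noteq> Inl u" "n \<noteq> Inl v" by auto
  qed
  have RN: "R \<subseteq> nodes G" using walk_last(1) uv by (auto simp: R_def nodes_def)
  have vR: "Inl v \<notin> R" using walk_last(3) uv by (auto simp: R_def)
  have "R \<inter> S' = {}"
  proof -
    have "n \<notin> S" if "walk ?r ?A {n} xs" "set xs \<inter> S = {}" for n xs
      using that last_in_set[of xs] by (auto simp: walk_def)
    then show ?thesis by (auto simp: R_def S'_def)
  qed
  moreover have "\<not> incident G n m" if n: "n \<in> R" and m: "m \<in> B" for n m
  proof
    assume nm: "incident G n m"
    have m': "m \<in> nodes G" "m \<notin> R" "m \<notin> S'" "m \<noteq> Inl u" using m by (auto simp: B_def R_def)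
    show False
    proof (cases "n = Inl u")
      case True
      then have "m \<notin> S" "m \<in> ?A" using nm m' by (auto simp: S'_def incident_Inl)
      then have "walk ?r ?A {m} [m]" "set [m] \<inter> S = {}" by (auto simp: walk_def)
      then show False using m'(2) unfolding R_def by blast
    next
      case False
      then obtain xs where xs: "walk ?r ?A {n} xs" "set xs \<inter> S = {}" using n by (auto simp: R_def)
      show False
      proof (cases "m = Inl v")
        case True
        then have "walk ?r ?A ?B xs" using xs incident_sym[OF nm] by (auto simp: walk_def)
        then show False using S(2) xs(2) by (auto simp: meets_walks_def)
      next
        case False
        then have "m \<notin> S" "(n, m) \<in> ?r" using m' nm walk_last[OF xs(1)] by (auto simp: S'_def)
        then have "walk ?r ?A {m} (xs @ [m])" "set (xs @ [m]) \<inter> S = {}"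
          using xs by (auto simp: walk_def successively_append_iff)
        then show False using m'(2) unfolding R_def by blast
      qed
    qed
  qed
  ultimately have "separation (nodes G) (incident G) R S' B"
    using RN unfolding separation_def B_def S'_def by blast
  moreover have "Inl v \<in> B" using vR uv by (auto simp: B_def S'_def nodes_def)
  moreover have "card S' < k"
  proof -
    have "S' \<subseteq> S" by (auto simp: S'_def)
    then show ?thesis using S(1,3) card_mono[of S S'] by simp
  qed
  ultimately show "\<exists>A S B. separation (nodes G) (incident G) A S B \<and> Inl u \<in> A \<and> Inl v \<in> B \<and> card S < k"
    by (intro exI[of _ R] exI[of _ S'] exI[of _ B]) (auto simp: R_def)
qed

section \<open>The subdivision satisfies the abstract assumptions\<close>

lemma max_independent_paths_ge:
  "P \<subseteq> paths_between G u v \<Longrightarrow> independent_paths P \<Longrightarrow> card P \<le> max_independent_paths G u v"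
  unfolding max_independent_paths_def using finite_independent_path_sets by (intro Max_ge) auto

lemma max_independent_paths_attained:
  obtains P where "P \<subseteq> paths_between G u v" "independent_paths P" "card P = max_independent_paths G u v"
proof -
  have "max_independent_paths G u v \<in> card ` {P. P \<subseteq> paths_between G u v \<and> independent_paths P}"
    unfolding max_independent_paths_def
    using finite_independent_path_sets independent_path_sets_nonempty by (intro Max_in) auto
  then show ?thesis using that by auto
qed

lemma uniform_incidence_of_uniform:
  assumes "uniformly_3_connected G"
  shows "uniform_incidence (nodes G) (Inl ` verts G) (incident G)"
proof
  have three: "max_independent_paths G u v = 3" if "u \<in> verts G" "v \<in> verts G" "u \<noteq> v" for u v
    using assms that by (simp add: uniformly_3_connected_def)
  show "finite (nodes G)" by (rule finite_nodes)
  show "Inl ` verts G \<subseteq> nodes G" by (auto simp: nodes_def)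
  show "incident G y x" if "incident G x y" for x y using that by (rule incident_sym)
  show "x \<in> nodes G" if "incident G x y" for x y using that by (rule incident_nodes)
  show "y \<notin> Inl ` verts G" if "incident G x y" "x \<in> Inl ` verts G" for x y
    using that by (auto simp: incident_Inl)
  show "4 \<le> card (Inl ` verts G :: ('v + 'e) set)"
    using assms by (simp add: uniformly_3_connected_def card_image)
  show "\<exists>x y. x \<in> Inl ` verts G \<and> y \<in> Inl ` verts G \<and> x \<noteq> y \<and> (\<forall>z. incident G e z \<longleftrightarrow> z = x \<or> z = y)"
    if "e \<in> nodes G" "e \<notin> Inl ` verts G" for e
  proof -
    obtain f where f: "e = Inr f" "f \<in> edges G" using \<open>e \<in> nodes G\<close> \<open>e \<notin> _\<close> by (auto simp: nodes_def)
    then obtain x y where xy: "ends G f = {x, y}" "x \<noteq> y" using card_ends by (metis card_2_iff)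
    then have "incident G e z \<longleftrightarrow> z = Inl x \<or> z = Inl y" for z using f by (cases z) auto
    then show ?thesis using xy ends_in_verts[OF f(2)] by (intro exI[of _ "Inl x"] exI[of _ "Inl y"]) auto
  qed
  show ge: "3 \<le> card S"
    if S: "separation (nodes G) (incident G) A S B"
      and xy: "x \<in> Inl ` verts G" "y \<in> Inl ` verts G" "x \<in> A" "y \<in> B" for A S B x y
  proof -
    obtain u v where uv: "x = Inl u" "y = Inl v" "u \<in> verts G" "v \<in> verts G" using xy by blast
    have "u \<noteq> v" using S xy uv unfolding separation_def by blast
    obtain P where "P \<subseteq> paths_between G u v" "independent_paths P" "card P = max_independent_paths G u v"
      by (rule max_independent_paths_attained)
    then show ?thesis
      using independent_paths_card_le[OF fin_multigraph_axioms S, of u v P] three uv xy \<open>u \<noteq> v\<close> by simp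
  qed
  show "\<exists>A S B. separation (nodes G) (incident G) A S B \<and> x \<in> A \<and> y \<in> B \<and> card S = 3"
    if xy: "x \<in> Inl ` verts G" "y \<in> Inl ` verts G" "x \<noteq> y" for x y
  proof -
    obtain u v where uv: "x = Inl u" "y = Inl v" "u \<in> verts G" "v \<in> verts G" "u \<noteq> v" using xy by blast
    have "\<not> (\<exists>P. P \<subseteq> paths_between G u v \<and> independent_paths P \<and> card P = 4)"
    proof
      assume "\<exists>P. P \<subseteq> paths_between G u v \<and> independent_paths P \<and> card P = 4"
      then obtain P where P: "P \<subseteq> paths_between G u v" "independent_paths P" "card P = 4" by blast
      then show False using max_independent_paths_ge[OF P(1,2)] three[OF uv(3-5)] by simp
    qed
    then obtain A S B where S: "separation (nodes G) (incident G) A S B" "Inl u \<in> A" "Inl v \<in> B" "card S < 4"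
      using separation_or_paths[OF uv(3-5), of 4] by blast
    moreover have "3 \<le> card S" using ge[OF S(1)] S(2,3) xy uv by blast
    ultimately show ?thesis using uv by (intro exI[of _ A] exI[of _ S] exI[of _ B]) auto
  qed
qed

lemma degree_incident: "card {e. incident G (Inl v) e} = degree G v"
proof -
  have "{e. incident G (Inl v) e} = Inr ` {e \<in> edges G. v \<in> ends G e}"
    by (auto simp: incident_Inl)
  then show ?thesis by (simp add: degree_def card_image)
qed

end

theorem theorem13:
  fixes G :: "('v, 'e) multigraph" and n :: nat
  assumes "fin_multigraph G"
    and "uniformly_3_connected G"
    and "n = card (verts G)"
  shows "real (num_min_degree G) \<ge> (2 * real n + 2) / 3"
proof -
  interpret fin_multigraph G by fact
  interpret U: uniform_incidence "nodes G" "Inl ` verts G" "incident G"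
    using assms(2) by (rule uniform_incidence_of_uniform)
  define L where "L = {v \<in> verts G. degree G v = 3}"
  define H where "H = {v \<in> verts G. degree G v \<noteq> 3}"
  have "{x \<in> Inl ` verts G. card {e. incident G x e} = 3} = Inl ` L"
    "{x \<in> Inl ` verts G. card {e. incident G x e} \<noteq> 3} = Inl ` H"
    by (auto simp: L_def H_def degree_incident)
  then have count: "2 * card H + 2 \<le> card L"
    using U.degree_three_count by (simp add: card_image)
  have n: "n = card L + card H"
    unfolding assms(3) L_def H_def using finite_verts
    by (subst card_Un_disjoint[symmetric]) (auto intro: arg_cong[of _ _ card])
  have ge: "3 \<le> degree G v" if "v \<in> verts G" for v
    using U.degree_ge[of "Inl v"] that by (simp add: degree_incident)
  have "L \<noteq> {}" using count by auto
  then have "min_degree G = 3"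
    unfolding min_degree_def using finite_verts ge by (intro Min_eqI) (auto simp: L_def)
  then have "num_min_degree G = card L" by (simp add: num_min_degree_def L_def)
  \<comment> \<open>Eliminating \<open>card H\<close> from
    \<open>2 * card H + 2 \<le> card L\<close> and \<open>n = card L + card H\<close> gives
    \<open>3 * card L \<ge> 2 * n + 2\<close>.\<close>
  then show ?thesis using count n by simp
qed

end
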